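(* In the language $\mathsf{PCFL}_\oplus$, the simulation preorder $\precsim_\circ$ is a precongruence (a transitive and compatible typed relation) which is included in the contextual preorder $\leq$, i.e. $\Gamma\vdash M\precsim_\circ N:\sigma$ implies $\Gamma\vdash M\leq N:\sigma$. Analogously, bisimulation equivalence $\backsim_\circ$ is a congruence (a symmetric, transitive and compatible typed relation) which is included in context equivalence $\equiv$.
   Context: $\mathsf{PCFL}_\oplus$. Terms: $M,N,L::= x\mid \underline{n}\ (n\in\mathbb{N})\mid \underline{b}\ (b\in\{\mathsf{true},\mathsf{false}\})\mid \mathsf{nil}\mid \langle M,N\rangle\mid M::N\mid \lambda x.M\mid \mathsf{fix}\,x.M\mid M\oplus N\mid \mathsf{if}\ L\ \mathsf{then}\ M\ \mathsf{else}\ N\mid \mathsf{op}(M,N)\mid \mathsf{fst}\,M\mid \mathsf{snd}\,M\mid \mathsf{case}\ L\ \mathsf{of}\ \{\mathsf{nil}\to M\mid h::t\to N\}\mid MN$, where $\mathsf{op}$ ranges over a fixed finite set of binary operators on natural numbers (containing $+,\leq,=$), each with a result type $\mathbf{int}$ or $\mathbf{bool}$; $\mathsf{fix}\,x.M$ binds $x$, and the case construct binds $h,t$ in $N$. Types: $\sigma::=\mathbf{bool}\mid\mathbf{int}\mid\sigma\to\sigma\mid\sigma\times\sigma\mid[\sigma]$. Typing $\Gamma\vdash M:\sigma$ is the standard simply-typed one; in particular $\mathsf{nil}:[\sigma]$, $H::T:[\sigma]$ if $H:\sigma,T:[\sigma]$; $M\oplus N:\sigma$ and $\mathsf{if}$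 require both branches of type $\sigma$; $\mathsf{op}$ takes two $\mathbf{int}$ arguments; $\mathsf{case}\ L\ \mathsf{of}\{\dots\}:\tau$ if $L:[\sigma]$, $M:\tau$, and $h:\sigma,t:[\sigma]\vdash N:\tau$; $\Gamma\vdash\mathsf{fix}\,x.M:\sigma\to\tau$ if $\Gamma,x:\sigma\to\tau\vdash M:\sigma\to\tau$. Values: $V::=\underline n\mid\underline b\mid\mathsf{nil}\mid\lambda x.M\mid\mathsf{fix}\,x.M\mid M::N\mid\langle M,N\rangle$ (arbitrary $M,N$: pairs and lists are lazy). Call-by-value semantics: evaluation contexts $E::=[\cdot]\mid EM\mid VE\mid \mathsf{op}(E,M)\mid\mathsf{op}(V,E)\mid\mathsf{fst}\,E\mid\mathsf{snd}\,E\mid\mathsf{if}\ E\ \mathsf{then}\ M\ \mathsf{else}\ N\mid \mathsf{case}\ E\ \mathsf{of}\{\dots\}\mid\mathsf{case}\ (E::M)\ \mathsf{of}\{\dots\}\mid\mathsf{case}\ (V::E)\ \mathsf{of}\{\dots\}$; one-step reduction maps a closed term to a finite sequence of closed terms: $(\lambda x.M)V\to M[V/x]$; $(\mathsf{fix}\,x.M)V\to (M[\mathsf{fix}\,x.M/x])V$; $\mathsf{op}(\underline n,\underline m)\to$ the value of the operator; $\mathsf{fst}\langle M,N\rangle\to M$; $\mathsf{snd}\langle M,N\rangle\to N$; $\mathsf{if}\ \underline{\mathsf{true}}\ \mathsf{then}\ M\ \mathsf{else}\ N\to M$ (similarly for false); $\mathsf{case}\ \mathsf{nil}\ \mathsf{of}\{\mathsf{nil}\to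 M\mid h::t\to N\}\to M$; $\mathsf{case}\ V::W\ \mathsf{of}\{\dots\}\to N[V/h,W/t]$; $M\oplus N\to M,N$; closed under evaluation contexts. The relation $\Rightarrow$ between closed terms and subprobability distributions on values is inductively given by: $M\Rightarrow\emptyset$; $V\Rightarrow\{V^1\}$; if $M\to N_1,\dots,N_n$ and $N_i\Rightarrow\mathscr{D}_i$ then $M\Rightarrow\sum_i\frac1n\mathscr{D}_i$. The semantics $[\![M]\!]$ is the pointwise supremum of all $\mathscr{D}$ with $M\Rightarrow\mathscr{D}$; $\sum[\![M]\!]$ is its total mass. Contexts are terms with exactly one hole $[\cdot]$ ($C[M]$ fills the hole, possibly capturing variables); $\emptyset\vdash C(\Gamma;\tau):\sigma$ means $C$ is well typed so that for every $M$ with $\Gamma\vdash M:\tau$, $C[M]$ is a closed term of type $\sigma$. Contextual preorder: $\Gamma\vdash M\leq N:\tau$ iff for all such $C$ (any $\sigma$), $\sum[\![C[M]]\!]\leq\sum[\![C[N]]\!]$; context equivalence $\equiv$ is $\leq$ in both directions. A typed relation is a family of relations $\mathcal{R}^\Gamma_\sigma$ on terms typable as $\Gamma\vdash\cdot:\sigma$; it is compatible if it relates each variable and constant to itself and is closed under all term constructors (whenever the immediate subterms are pairwise related at the right types and contexts, so are the composite terms). Applicative (bi)simulation: the labelled Markov chain $\mathcal{M}_\oplus$ has states $(M,\sigma)$ for closed $M:\sigma$ and $(\hat V,\sigma)$ for closed values $V:\sigma$ (a distinct copy); labels are types, closed values, naturals, booleans, $\mathit{nil},\mathit{hd},\mathit{tl},\mathit{fst},\mathit{snd},\mathit{eval}$.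 Transition probabilities $\mathcal{P}_\oplus$: every state with type $\sigma$ goes by label $\sigma$ to itself with probability 1; $(M,\sigma)\xrightarrow{\mathit{eval}}(\hat V,\sigma)$ with probability $[\![M]\!](V)$; for $\sigma=\tau\to\theta$ and closed value $W:\tau$: $(\widehat{\lambda x.M},\sigma)\xrightarrow{W}(M[W/x],\theta)$ and $(\widehat{\mathsf{fix}\,x.M},\sigma)\xrightarrow{W}((M[\mathsf{fix}\,x.M/x])W,\theta)$ with probability 1; $(\widehat{\langle M,N\rangle},\tau\times\theta)$ goes by $\mathit{fst}$ to $(M,\tau)$ and by $\mathit{snd}$ to $(N,\theta)$; $(\hat{\underline k},\mathbf{int})\xrightarrow{k}$ itself, $(\hat{\underline b},\mathbf{bool})\xrightarrow{b}$ itself; $(\hat{\mathsf{nil}},[\tau])\xrightarrow{\mathit{nil}}$ itself; $(\widehat{M::N},[\tau])$ goes by $\mathit{hd}$ to $(M,\tau)$ and by $\mathit{tl}$ to $(N,[\tau])$; all other probabilities are 0. A (Larsen–Skou) simulation is a preorder $R$ on states such that $sRt$ implies $\mathcal{P}_\oplus(s,l,X)\leq\mathcal{P}_\oplus(t,l,R(X))$ for all labels $l$ and sets of states $X$, where $R(X)=\{y\mid\exists x\in X,xRy\}$ and $\mathcal{P}(s,l,X)=\sum_{x\in X}\mathcal{P}(s,l,x)$; a bisimulation is an equivalence relation $R$ such that $sRt$ implies $\mathcal{P}_\oplus(s,l,E)=\mathcal{P}_\oplus(t,l,E)$ for every label $l$ and $R$-equivalence class $E$. Similarity $\precsim$ (resp.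 bisimilarity $\backsim$) is the union of all simulations (resp. bisimulations). For $\Gamma=x_1:\tau_1,\dots,x_n:\tau_n$, the simulation preorder is $\Gamma\vdash M\precsim_\circ N:\sigma$ iff for all closed values $V_i:\tau_i$, $(M[\overline V/\overline x],\sigma)\precsim(N[\overline V/\overline x],\sigma)$; bisimulation equivalence $\backsim_\circ$ is defined likewise from $\backsim$. *)

theory Defs
  imports "HOL-Analysis.Infinite_Sum" "HOL-Library.Finite_Map"
begin

section \<open>Syntax\<close>

datatype operation = IntOp "nat \<Rightarrow> nat \<Rightarrow> nat" | BoolOp "nat \<Rightarrow> nat \<Rightarrow> bool"

text \<open>The fixed finite set of operator symbols is a type of the following class; results
  polymorphic in such a type hold for every choice of operators.\<close>

class operators = finite +
  fixes interp :: "'a \<Rightarrow> operation"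
  assumes plus_operator: "IntOp (+) \<in> range interp"
    and le_operator: "BoolOp (\<le>) \<in> range interp"
    and eq_operator: "BoolOp (=) \<in> range interp"

type_synonym var = nat

datatype ty = TBool | TInt | TFun ty ty | TProd ty ty | TList ty

text \<open>\<open>CaseT L M h t N\<close> is the case construct with branches \<open>nil \<rightarrow> M\<close> and \<open>h::t \<rightarrow> N\<close>.\<close>

datatype 'op tm =
    Var var
  | Num nat
  | Bool bool
  | NilT
  | PairT "'op tm" "'op tm"
  | ConsT "'op tm" "'op tm"
  | Lam var "'op tm"
  | Fix var "'op tm"
  | Choice "'op tm" "'op tm"
  | IfT "'op tm" "'op tm" "'op tm"
  | OpT 'op "'op tm" "'op tm"
  | Fst "'op tm"
  | Snd "'op tm"
  | CaseT "'op tm" "'op tm" var var "'op tm"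
  | App "'op tm" "'op tm"

text \<open>Simultaneous substitution. Only closed terms are ever substituted, both in the reduction of
  closed terms and in the open extension of a relation, so no variable can be captured and
  bound variables need not be renamed.\<close>

primrec subst :: "(var \<rightharpoonup> 'op tm) \<Rightarrow> 'op tm \<Rightarrow> 'op tm" where
  "subst \<theta> (Var x) = (case \<theta> x of Some V \<Rightarrow> V | None \<Rightarrow> Var x)"
| "subst \<theta> (Num n) = Num n"
| "subst \<theta> (Bool b) = Bool b"
| "subst \<theta> NilT = NilT"
| "subst \<theta> (PairT M N) = PairT (subst \<theta> M) (subst \<theta> N)"
| "subst \<theta> (ConsT M N) = ConsT (subst \<theta> M) (subst \<theta> N)"
| "subst \<theta> (Lam x M) = Lam x (subst (\<theta>(x := None)) M)"
| "subst \<theta> (Fix x M) = Fix x (subst (\<theta>(x := None)) M)"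
| "subst \<theta> (Choice M N) = Choice (subst \<theta> M) (subst \<theta> N)"
| "subst \<theta> (IfT L M N) = IfT (subst \<theta> L) (subst \<theta> M) (subst \<theta> N)"
| "subst \<theta> (OpT f M N) = OpT f (subst \<theta> M) (subst \<theta> N)"
| "subst \<theta> (Fst M) = Fst (subst \<theta> M)"
| "subst \<theta> (Snd M) = Snd (subst \<theta> M)"
| "subst \<theta> (CaseT L M h t N) =
     CaseT (subst \<theta> L) (subst \<theta> M) h t (subst (\<theta>(h := None, t := None)) N)"
| "subst \<theta> (App M N) = App (subst \<theta> M) (subst \<theta> N)"


section \<open>Typing\<close>

type_synonym tyenv = "(var, ty) fmap"

primrec op_type :: "operation \<Rightarrow> ty" where
  "op_type (IntOp f) = TInt"
| "op_type (BoolOp f) = TBool"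

inductive typing :: "tyenv \<Rightarrow> 'op::operators tm \<Rightarrow> ty \<Rightarrow> bool"
    (\<open>_ \<turnstile> _ \<Colon> _\<close> [60, 60, 60] 60) where
  ty_Var: "fmlookup \<Gamma> x = Some \<sigma> \<Longrightarrow> \<Gamma> \<turnstile> Var x \<Colon> \<sigma>"
| ty_Num: "\<Gamma> \<turnstile> Num n \<Colon> TInt"
| ty_Bool: "\<Gamma> \<turnstile> Bool b \<Colon> TBool"
| ty_Nil: "\<Gamma> \<turnstile> NilT \<Colon> TList \<sigma>"
| ty_Pair: "\<Gamma> \<turnstile> M \<Colon> \<sigma> \<Longrightarrow> \<Gamma> \<turnstile> N \<Colon> \<tau> \<Longrightarrow> \<Gamma> \<turnstile> PairT M N \<Colon> TProd \<sigma> \<tau>"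
| ty_Cons: "\<Gamma> \<turnstile> M \<Colon> \<sigma> \<Longrightarrow> \<Gamma> \<turnstile> N \<Colon> TList \<sigma> \<Longrightarrow> \<Gamma> \<turnstile> ConsT M N \<Colon> TList \<sigma>"
| ty_Lam: "fmupd x \<sigma> \<Gamma> \<turnstile> M \<Colon> \<tau> \<Longrightarrow> \<Gamma> \<turnstile> Lam x M \<Colon> TFun \<sigma> \<tau>"
| ty_Fix: "fmupd x (TFun \<sigma> \<tau>) \<Gamma> \<turnstile> M \<Colon> TFun \<sigma> \<tau> \<Longrightarrow> \<Gamma> \<turnstile> Fix x M \<Colon> TFun \<sigma> \<tau>"
| ty_Choice: "\<Gamma> \<turnstile> M \<Colon> \<sigma> \<Longrightarrow> \<Gamma> \<turnstile> N \<Colon> \<sigma> \<Longrightarrow> \<Gamma> \<turnstile> Choice M N \<Colon> \<sigma>"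
| ty_If: "\<Gamma> \<turnstile> L \<Colon> TBool \<Longrightarrow> \<Gamma> \<turnstile> M \<Colon> \<sigma> \<Longrightarrow> \<Gamma> \<turnstile> N \<Colon> \<sigma> \<Longrightarrow> \<Gamma> \<turnstile> IfT L M N \<Colon> \<sigma>"
| ty_Op: "\<Gamma> \<turnstile> M \<Colon> TInt \<Longrightarrow> \<Gamma> \<turnstile> N \<Colon> TInt \<Longrightarrow> \<Gamma> \<turnstile> OpT f M N \<Colon> op_type (interp f)"
| ty_Fst: "\<Gamma> \<turnstile> M \<Colon> TProd \<sigma> \<tau> \<Longrightarrow> \<Gamma> \<turnstile> Fst M \<Colon> \<sigma>"
| ty_Snd: "\<Gamma> \<turnstile> M \<Colon> TProd \<sigma> \<tau> \<Longrightarrow> \<Gamma> \<turnstile> Snd M \<Colon> \<tau>"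
| ty_Case: "\<Gamma> \<turnstile> L \<Colon> TList \<sigma> \<Longrightarrow> \<Gamma> \<turnstile> M \<Colon> \<tau> \<Longrightarrow> h \<noteq> t \<Longrightarrow>
     fmupd t (TList \<sigma>) (fmupd h \<sigma> \<Gamma>) \<turnstile> N \<Colon> \<tau> \<Longrightarrow> \<Gamma> \<turnstile> CaseT L M h t N \<Colon> \<tau>"
| ty_App: "\<Gamma> \<turnstile> M \<Colon> TFun \<sigma> \<tau> \<Longrightarrow> \<Gamma> \<turnstile> N \<Colon> \<sigma> \<Longrightarrow> \<Gamma> \<turnstile> App M N \<Colon> \<tau>"


section \<open>Operational semantics\<close>

primrec is_value :: "'op tm \<Rightarrow> bool" where
  "is_value (Var x) = False"
| "is_value (Num n) = True"
| "is_value (Bool b) = True"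
| "is_value NilT = True"
| "is_value (PairT M N) = True"
| "is_value (ConsT M N) = True"
| "is_value (Lam x M) = True"
| "is_value (Fix x M) = True"
| "is_value (Choice M N) = False"
| "is_value (IfT L M N) = False"
| "is_value (OpT f M N) = False"
| "is_value (Fst M) = False"
| "is_value (Snd M) = False"
| "is_value (CaseT L M h t N) = False"
| "is_value (App M N) = False"

text \<open>Evaluation contexts bind no variables, so they are represented by their filling functions.\<close>

inductive evctx :: "('op tm \<Rightarrow> 'op tm) \<Rightarrow> bool" where
  "evctx (\<lambda>X. X)"
| "evctx E \<Longrightarrow> evctx (\<lambda>X. App (E X) M)"
| "is_value V \<Longrightarrow> evctx E \<Longrightarrow> evctx (\<lambda>X. App V (E X))"
| "evctx E \<Longrightarrow> evctx (\<lambda>X. OpT f (E X) M)"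
| "is_value V \<Longrightarrow> evctx E \<Longrightarrow> evctx (\<lambda>X. OpT f V (E X))"
| "evctx E \<Longrightarrow> evctx (\<lambda>X. Fst (E X))"
| "evctx E \<Longrightarrow> evctx (\<lambda>X. Snd (E X))"
| "evctx E \<Longrightarrow> evctx (\<lambda>X. IfT (E X) M N)"
| "evctx E \<Longrightarrow> evctx (\<lambda>X. CaseT (E X) M h t N)"
| "evctx E \<Longrightarrow> evctx (\<lambda>X. CaseT (ConsT (E X) L) M h t N)"
| "is_value V \<Longrightarrow> evctx E \<Longrightarrow> evctx (\<lambda>X. CaseT (ConsT V (E X)) M h t N)"

primrec op_apply :: "operation \<Rightarrow> nat \<Rightarrow> nat \<Rightarrow> 'op tm" where
  "op_apply (IntOp f) m n = Num (f m n)"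
| "op_apply (BoolOp f) m n = Bool (f m n)"

inductive redex :: "'op::operators tm \<Rightarrow> 'op tm list \<Rightarrow> bool" where
  "is_value V \<Longrightarrow> redex (App (Lam x M) V) [subst [x \<mapsto> V] M]"
| "is_value V \<Longrightarrow> redex (App (Fix x M) V) [App (subst [x \<mapsto> Fix x M] M) V]"
| "redex (OpT f (Num m) (Num n)) [op_apply (interp f) m n]"
| "redex (Fst (PairT M N)) [M]"
| "redex (Snd (PairT M N)) [N]"
| "redex (IfT (Bool True) M N) [M]"
| "redex (IfT (Bool False) M N) [N]"
| "redex (CaseT NilT M h t N) [M]"
| "is_value V \<Longrightarrow> is_value W \<Longrightarrow> redex (CaseT (ConsT V W) M h t N) [subst [h \<mapsto> V, t \<mapsto> W] N]"
| "redex (Choice M N) [M, N]"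

inductive step :: "'op::operators tm \<Rightarrow> 'op tm list \<Rightarrow> bool" where
  "redex M Ns \<Longrightarrow> evctx E \<Longrightarrow> step (E M) (map E Ns)"

inductive approx :: "'op::operators tm \<Rightarrow> ('op tm \<Rightarrow> ennreal) \<Rightarrow> bool" where
  approx_empty: "approx M (\<lambda>_. 0)"
| approx_value: "is_value V \<Longrightarrow> approx V (\<lambda>W. if W = V then 1 else 0)"
| approx_step: "step M Ns \<Longrightarrow> list_all2 approx Ns Ds \<Longrightarrow>
     approx M (\<lambda>V. \<Sum>D\<leftarrow>Ds. 1 / of_nat (length Ns) * D V)"

definition sem :: "'op::operators tm \<Rightarrow> 'op tm \<Rightarrow> ennreal" where
  "sem M V = (SUP D \<in> {D. approx M D}. D V)"

definition mass :: "'op::operators tm \<Rightarrow> ennreal" where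
  "mass M = (\<Sum>\<^sub>\<infinity> V \<in> {V. is_value V}. sem M V)"


section \<open>Contextual preorder and equivalence\<close>

datatype 'op ctx =
    CHole
  | CPair1 "'op ctx" "'op tm" | CPair2 "'op tm" "'op ctx"
  | CCons1 "'op ctx" "'op tm" | CCons2 "'op tm" "'op ctx"
  | CLam var "'op ctx"
  | CFix var "'op ctx"
  | CChoice1 "'op ctx" "'op tm" | CChoice2 "'op tm" "'op ctx"
  | CIf1 "'op ctx" "'op tm" "'op tm" | CIf2 "'op tm" "'op ctx" "'op tm"
  | CIf3 "'op tm" "'op tm" "'op ctx"
  | COp1 'op "'op ctx" "'op tm" | COp2 'op "'op tm" "'op ctx"
  | CFst "'op ctx"
  | CSnd "'op ctx"
  | CCase1 "'op ctx" "'op tm" var var "'op tm" | CCase2 "'op tm" "'op ctx" var var "'op tm"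
  | CCase3 "'op tm" "'op tm" var var "'op ctx"
  | CApp1 "'op ctx" "'op tm" | CApp2 "'op tm" "'op ctx"

primrec plug :: "'op ctx \<Rightarrow> 'op tm \<Rightarrow> 'op tm" where
  "plug CHole X = X"
| "plug (CPair1 C N) X = PairT (plug C X) N"
| "plug (CPair2 M C) X = PairT M (plug C X)"
| "plug (CCons1 C N) X = ConsT (plug C X) N"
| "plug (CCons2 M C) X = ConsT M (plug C X)"
| "plug (CLam x C) X = Lam x (plug C X)"
| "plug (CFix x C) X = Fix x (plug C X)"
| "plug (CChoice1 C N) X = Choice (plug C X) N"
| "plug (CChoice2 M C) X = Choice M (plug C X)"
| "plug (CIf1 C M N) X = IfT (plug C X) M N"
| "plug (CIf2 L C N) X = IfT L (plug C X) N"
| "plug (CIf3 L M C) X = IfT L M (plug C X)"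
| "plug (COp1 f C N) X = OpT f (plug C X) N"
| "plug (COp2 f M C) X = OpT f M (plug C X)"
| "plug (CFst C) X = Fst (plug C X)"
| "plug (CSnd C) X = Snd (plug C X)"
| "plug (CCase1 C M h t N) X = CaseT (plug C X) M h t N"
| "plug (CCase2 L C h t N) X = CaseT L (plug C X) h t N"
| "plug (CCase3 L M h t C) X = CaseT L M h t (plug C X)"
| "plug (CApp1 C N) X = App (plug C X) N"
| "plug (CApp2 M C) X = App M (plug C X)"

text \<open>\<open>ctx_typing \<Gamma> \<tau> \<Delta> C \<sigma>\<close> stands for \<open>\<Delta> \<turnstile> C(\<Gamma>; \<tau>) : \<sigma>\<close>. The environment in scope at the hole may
  contain more variables than \<open>\<Gamma>\<close>.\<close>

inductive ctx_typing :: "tyenv \<Rightarrow> ty \<Rightarrow> tyenv \<Rightarrow> 'op::operators ctx \<Rightarrow> ty \<Rightarrow> bool"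
  for \<Gamma> :: tyenv and \<tau> :: ty where
  "\<Gamma> \<subseteq>\<^sub>f \<Delta> \<Longrightarrow> ctx_typing \<Gamma> \<tau> \<Delta> CHole \<tau>"
| "ctx_typing \<Gamma> \<tau> \<Delta> C \<sigma> \<Longrightarrow> \<Delta> \<turnstile> N \<Colon> \<rho> \<Longrightarrow> ctx_typing \<Gamma> \<tau> \<Delta> (CPair1 C N) (TProd \<sigma> \<rho>)"
| "\<Delta> \<turnstile> M \<Colon> \<sigma> \<Longrightarrow> ctx_typing \<Gamma> \<tau> \<Delta> C \<rho> \<Longrightarrow> ctx_typing \<Gamma> \<tau> \<Delta> (CPair2 M C) (TProd \<sigma> \<rho>)"
| "ctx_typing \<Gamma> \<tau> \<Delta> C \<sigma> \<Longrightarrow> \<Delta> \<turnstile> N \<Colon> TList \<sigma> \<Longrightarrow> ctx_typing \<Gamma> \<tau> \<Delta> (CCons1 C N) (TList \<sigma>)"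
| "\<Delta> \<turnstile> M \<Colon> \<sigma> \<Longrightarrow> ctx_typing \<Gamma> \<tau> \<Delta> C (TList \<sigma>) \<Longrightarrow> ctx_typing \<Gamma> \<tau> \<Delta> (CCons2 M C) (TList \<sigma>)"
| "ctx_typing \<Gamma> \<tau> (fmupd x \<sigma> \<Delta>) C \<rho> \<Longrightarrow> ctx_typing \<Gamma> \<tau> \<Delta> (CLam x C) (TFun \<sigma> \<rho>)"
| "ctx_typing \<Gamma> \<tau> (fmupd x (TFun \<sigma> \<rho>) \<Delta>) C (TFun \<sigma> \<rho>) \<Longrightarrow>
     ctx_typing \<Gamma> \<tau> \<Delta> (CFix x C) (TFun \<sigma> \<rho>)"
| "ctx_typing \<Gamma> \<tau> \<Delta> C \<sigma> \<Longrightarrow> \<Delta> \<turnstile> N \<Colon> \<sigma> \<Longrightarrow> ctx_typing \<Gamma> \<tau> \<Delta> (CChoice1 C N) \<sigma>"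
| "\<Delta> \<turnstile> M \<Colon> \<sigma> \<Longrightarrow> ctx_typing \<Gamma> \<tau> \<Delta> C \<sigma> \<Longrightarrow> ctx_typing \<Gamma> \<tau> \<Delta> (CChoice2 M C) \<sigma>"
| "ctx_typing \<Gamma> \<tau> \<Delta> C TBool \<Longrightarrow> \<Delta> \<turnstile> M \<Colon> \<sigma> \<Longrightarrow> \<Delta> \<turnstile> N \<Colon> \<sigma> \<Longrightarrow> ctx_typing \<Gamma> \<tau> \<Delta> (CIf1 C M N) \<sigma>"
| "\<Delta> \<turnstile> L \<Colon> TBool \<Longrightarrow> ctx_typing \<Gamma> \<tau> \<Delta> C \<sigma> \<Longrightarrow> \<Delta> \<turnstile> N \<Colon> \<sigma> \<Longrightarrow> ctx_typing \<Gamma> \<tau> \<Delta> (CIf2 L C N) \<sigma>"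
| "\<Delta> \<turnstile> L \<Colon> TBool \<Longrightarrow> \<Delta> \<turnstile> M \<Colon> \<sigma> \<Longrightarrow> ctx_typing \<Gamma> \<tau> \<Delta> C \<sigma> \<Longrightarrow> ctx_typing \<Gamma> \<tau> \<Delta> (CIf3 L M C) \<sigma>"
| "ctx_typing \<Gamma> \<tau> \<Delta> C TInt \<Longrightarrow> \<Delta> \<turnstile> N \<Colon> TInt \<Longrightarrow>
     ctx_typing \<Gamma> \<tau> \<Delta> (COp1 f C N) (op_type (interp f))"
| "\<Delta> \<turnstile> M \<Colon> TInt \<Longrightarrow> ctx_typing \<Gamma> \<tau> \<Delta> C TInt \<Longrightarrow>
     ctx_typing \<Gamma> \<tau> \<Delta> (COp2 f M C) (op_type (interp f))"
| "ctx_typing \<Gamma> \<tau> \<Delta> C (TProd \<sigma> \<rho>) \<Longrightarrow> ctx_typing \<Gamma> \<tau> \<Delta> (CFst C) \<sigma>"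
| "ctx_typing \<Gamma> \<tau> \<Delta> C (TProd \<sigma> \<rho>) \<Longrightarrow> ctx_typing \<Gamma> \<tau> \<Delta> (CSnd C) \<rho>"
| "ctx_typing \<Gamma> \<tau> \<Delta> C (TList \<sigma>) \<Longrightarrow> \<Delta> \<turnstile> M \<Colon> \<rho> \<Longrightarrow> h \<noteq> t \<Longrightarrow>
     fmupd t (TList \<sigma>) (fmupd h \<sigma> \<Delta>) \<turnstile> N \<Colon> \<rho> \<Longrightarrow> ctx_typing \<Gamma> \<tau> \<Delta> (CCase1 C M h t N) \<rho>"
| "\<Delta> \<turnstile> L \<Colon> TList \<sigma> \<Longrightarrow> ctx_typing \<Gamma> \<tau> \<Delta> C \<rho> \<Longrightarrow> h \<noteq> t \<Longrightarrow>
     fmupd t (TList \<sigma>) (fmupd h \<sigma> \<Delta>) \<turnstile> N \<Colon> \<rho> \<Longrightarrow> ctx_typing \<Gamma> \<tau> \<Delta> (CCase2 L C h t N) \<rho>"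
| "\<Delta> \<turnstile> L \<Colon> TList \<sigma> \<Longrightarrow> \<Delta> \<turnstile> M \<Colon> \<rho> \<Longrightarrow> h \<noteq> t \<Longrightarrow>
     ctx_typing \<Gamma> \<tau> (fmupd t (TList \<sigma>) (fmupd h \<sigma> \<Delta>)) C \<rho> \<Longrightarrow>
     ctx_typing \<Gamma> \<tau> \<Delta> (CCase3 L M h t C) \<rho>"
| "ctx_typing \<Gamma> \<tau> \<Delta> C (TFun \<sigma> \<rho>) \<Longrightarrow> \<Delta> \<turnstile> N \<Colon> \<sigma> \<Longrightarrow> ctx_typing \<Gamma> \<tau> \<Delta> (CApp1 C N) \<rho>"
| "\<Delta> \<turnstile> M \<Colon> TFun \<sigma> \<rho> \<Longrightarrow> ctx_typing \<Gamma> \<tau> \<Delta> C \<sigma> \<Longrightarrow> ctx_typing \<Gamma> \<tau> \<Delta> (CApp2 M C) \<rho>"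

type_synonym 'op typed_rel = "tyenv \<Rightarrow> ty \<Rightarrow> 'op tm \<Rightarrow> 'op tm \<Rightarrow> bool"

definition ctx_preorder :: "'op::operators typed_rel" where
  "ctx_preorder \<Gamma> \<tau> M N \<longleftrightarrow> \<Gamma> \<turnstile> M \<Colon> \<tau> \<and> \<Gamma> \<turnstile> N \<Colon> \<tau> \<and>
     (\<forall>C \<sigma>. ctx_typing \<Gamma> \<tau> fmempty C \<sigma> \<longrightarrow> mass (plug C M) \<le> mass (plug C N))"

definition ctx_equiv :: "'op::operators typed_rel" where
  "ctx_equiv \<Gamma> \<tau> M N \<longleftrightarrow> ctx_preorder \<Gamma> \<tau> M N \<and> ctx_preorder \<Gamma> \<tau> N M"


section \<open>Precongruences and congruences\<close>

definition typed_relation :: "'op::operators typed_rel \<Rightarrow> bool" where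
  "typed_relation R \<longleftrightarrow> (\<forall>\<Gamma> \<sigma> M N. R \<Gamma> \<sigma> M N \<longrightarrow> \<Gamma> \<turnstile> M \<Colon> \<sigma> \<and> \<Gamma> \<turnstile> N \<Colon> \<sigma>)"

definition compatible :: "'op::operators typed_rel \<Rightarrow> bool" where
  "compatible R \<longleftrightarrow>
     (\<forall>\<Gamma> x \<sigma>. fmlookup \<Gamma> x = Some \<sigma> \<longrightarrow> R \<Gamma> \<sigma> (Var x) (Var x)) \<and>
     (\<forall>\<Gamma> n. R \<Gamma> TInt (Num n) (Num n)) \<and>
     (\<forall>\<Gamma> b. R \<Gamma> TBool (Bool b) (Bool b)) \<and>
     (\<forall>\<Gamma> \<sigma>. R \<Gamma> (TList \<sigma>) NilT NilT) \<and>
     (\<forall>\<Gamma> \<sigma> \<tau> M M' N N'. R \<Gamma> \<sigma> M M' \<longrightarrow> R \<Gamma> \<tau> N N' \<longrightarrow>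
        R \<Gamma> (TProd \<sigma> \<tau>) (PairT M N) (PairT M' N')) \<and>
     (\<forall>\<Gamma> \<sigma> M M' N N'. R \<Gamma> \<sigma> M M' \<longrightarrow> R \<Gamma> (TList \<sigma>) N N' \<longrightarrow>
        R \<Gamma> (TList \<sigma>) (ConsT M N) (ConsT M' N')) \<and>
     (\<forall>\<Gamma> x \<sigma> \<tau> M M'. R (fmupd x \<sigma> \<Gamma>) \<tau> M M' \<longrightarrow> R \<Gamma> (TFun \<sigma> \<tau>) (Lam x M) (Lam x M')) \<and>
     (\<forall>\<Gamma> x \<sigma> \<tau> M M'. R (fmupd x (TFun \<sigma> \<tau>) \<Gamma>) (TFun \<sigma> \<tau>) M M' \<longrightarrow>
        R \<Gamma> (TFun \<sigma> \<tau>) (Fix x M) (Fix x M')) \<and>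
     (\<forall>\<Gamma> \<sigma> M M' N N'. R \<Gamma> \<sigma> M M' \<longrightarrow> R \<Gamma> \<sigma> N N' \<longrightarrow>
        R \<Gamma> \<sigma> (Choice M N) (Choice M' N')) \<and>
     (\<forall>\<Gamma> \<sigma> L L' M M' N N'. R \<Gamma> TBool L L' \<longrightarrow> R \<Gamma> \<sigma> M M' \<longrightarrow> R \<Gamma> \<sigma> N N' \<longrightarrow>
        R \<Gamma> \<sigma> (IfT L M N) (IfT L' M' N')) \<and>
     (\<forall>\<Gamma> f M M' N N'. R \<Gamma> TInt M M' \<longrightarrow> R \<Gamma> TInt N N' \<longrightarrow>
        R \<Gamma> (op_type (interp f)) (OpT f M N) (OpT f M' N')) \<and>
     (\<forall>\<Gamma> \<sigma> \<tau> M M'. R \<Gamma> (TProd \<sigma> \<tau>) M M' \<longrightarrow> R \<Gamma> \<sigma> (Fst M) (Fst M')) \<and>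
     (\<forall>\<Gamma> \<sigma> \<tau> M M'. R \<Gamma> (TProd \<sigma> \<tau>) M M' \<longrightarrow> R \<Gamma> \<tau> (Snd M) (Snd M')) \<and>
     (\<forall>\<Gamma> \<sigma> \<tau> h t L L' M M' N N'. R \<Gamma> (TList \<sigma>) L L' \<longrightarrow> R \<Gamma> \<tau> M M' \<longrightarrow> h \<noteq> t \<longrightarrow>
        R (fmupd t (TList \<sigma>) (fmupd h \<sigma> \<Gamma>)) \<tau> N N' \<longrightarrow>
        R \<Gamma> \<tau> (CaseT L M h t N) (CaseT L' M' h t N')) \<and>
     (\<forall>\<Gamma> \<sigma> \<tau> M M' N N'. R \<Gamma> (TFun \<sigma> \<tau>) M M' \<longrightarrow> R \<Gamma> \<sigma> N N' \<longrightarrow>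
        R \<Gamma> \<tau> (App M N) (App M' N'))"

definition precongruence :: "'op::operators typed_rel \<Rightarrow> bool" where
  "precongruence R \<longleftrightarrow> typed_relation R \<and> (\<forall>\<Gamma> \<sigma>. transp (R \<Gamma> \<sigma>)) \<and> compatible R"

definition congruence :: "'op::operators typed_rel \<Rightarrow> bool" where
  "congruence R \<longleftrightarrow> typed_relation R \<and> (\<forall>\<Gamma> \<sigma>. symp (R \<Gamma> \<sigma>)) \<and> (\<forall>\<Gamma> \<sigma>. transp (R \<Gamma> \<sigma>)) \<and>
     compatible R"


section \<open>Applicative simulation and bisimulation\<close>

text \<open>\<open>VState V \<sigma>\<close> is the distinguished copy of the value \<open>V\<close> at type \<open>\<sigma>\<close>.\<close>

datatype 'op state = TState "'op tm" ty | VState "'op tm" ty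

primrec state_ty :: "'op state \<Rightarrow> ty" where
  "state_ty (TState M \<sigma>) = \<sigma>"
| "state_ty (VState V \<sigma>) = \<sigma>"

definition closed_values :: "ty \<Rightarrow> 'op::operators tm set" where
  "closed_values \<sigma> = {V. is_value V \<and> fmempty \<turnstile> V \<Colon> \<sigma>}"

definition states :: "'op::operators state set" where
  "states = {TState M \<sigma> | M \<sigma>. fmempty \<turnstile> M \<Colon> \<sigma>} \<union> {VState V \<sigma> | V \<sigma>. V \<in> closed_values \<sigma>}"

datatype 'op label =
  LType ty | LVal "'op tm" | LNum nat | LBool bool | LNil | LHd | LTl | LFst | LSnd | LEval

text \<open>The transitions that have probability one, i.e. all those not labelled \<open>eval\<close>.\<close>

inductive dtrans :: "'op::operators state \<Rightarrow> 'op label \<Rightarrow> 'op state \<Rightarrow> bool" where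
  "dtrans s (LType (state_ty s)) s"
| "W \<in> closed_values \<tau> \<Longrightarrow>
     dtrans (VState (Lam x M) (TFun \<tau> \<theta>)) (LVal W) (TState (subst [x \<mapsto> W] M) \<theta>)"
| "W \<in> closed_values \<tau> \<Longrightarrow>
     dtrans (VState (Fix x M) (TFun \<tau> \<theta>)) (LVal W) (TState (App (subst [x \<mapsto> Fix x M] M) W) \<theta>)"
| "dtrans (VState (PairT M N) (TProd \<tau> \<theta>)) LFst (TState M \<tau>)"
| "dtrans (VState (PairT M N) (TProd \<tau> \<theta>)) LSnd (TState N \<theta>)"
| "dtrans (VState (Num k) TInt) (LNum k) (VState (Num k) TInt)"
| "dtrans (VState (Bool b) TBool) (LBool b) (VState (Bool b) TBool)"
| "dtrans (VState NilT (TList \<tau>)) LNil (VState NilT (TList \<tau>))"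
| "dtrans (VState (ConsT M N) (TList \<tau>)) LHd (TState M \<tau>)"
| "dtrans (VState (ConsT M N) (TList \<tau>)) LTl (TState N (TList \<tau>))"

definition prob :: "'op::operators state \<Rightarrow> 'op label \<Rightarrow> 'op state \<Rightarrow> ennreal" where
  "prob s l t =
     (case (s, l, t) of
        (TState M \<sigma>, LEval, VState V \<tau>) \<Rightarrow> if \<tau> = \<sigma> then sem M V else 0
      | _ \<Rightarrow> if dtrans s l t then 1 else 0)"

definition prob_set :: "'op::operators state \<Rightarrow> 'op label \<Rightarrow> 'op state set \<Rightarrow> ennreal" where
  "prob_set s l X = (\<Sum>\<^sub>\<infinity> x \<in> X. prob s l x)"

definition simulation :: "'op::operators state rel \<Rightarrow> bool" where
  "simulation R \<longleftrightarrow> preorder_on states R \<and>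
     (\<forall>(s, t) \<in> R. \<forall>l. \<forall>X \<subseteq> states. prob_set s l X \<le> prob_set t l (R `` X))"

definition bisimulation :: "'op::operators state rel \<Rightarrow> bool" where
  "bisimulation R \<longleftrightarrow> equiv states R \<and>
     (\<forall>(s, t) \<in> R. \<forall>l. \<forall>E \<in> states // R. prob_set s l E = prob_set t l E)"

definition similarity :: "'op::operators state rel" where
  "similarity = \<Union> {R. simulation R}"

definition bisimilarity :: "'op::operators state rel" where
  "bisimilarity = \<Union> {R. bisimulation R}"

definition closing_subst :: "tyenv \<Rightarrow> (var \<rightharpoonup> 'op::operators tm) \<Rightarrow> bool" where
  "closing_subst \<Gamma> \<theta> \<longleftrightarrow> (\<forall>x. rel_option (\<lambda>\<tau> V. V \<in> closed_values \<tau>) (fmlookup \<Gamma> x) (\<theta> x))"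

definition open_extension :: "'op::operators state rel \<Rightarrow> 'op typed_rel" where
  "open_extension R \<Gamma> \<sigma> M N \<longleftrightarrow> \<Gamma> \<turnstile> M \<Colon> \<sigma> \<and> \<Gamma> \<turnstile> N \<Colon> \<sigma> \<and>
     (\<forall>\<theta>. closing_subst \<Gamma> \<theta> \<longrightarrow> (TState (subst \<theta> M) \<sigma>, TState (subst \<theta> N) \<sigma>) \<in> R)"

definition sim_preorder :: "'op::operators typed_rel" where
  "sim_preorder = open_extension similarity"

definition bisim_equiv :: "'op::operators typed_rel" where
  "bisim_equiv = open_extension bisimilarity"

end

theory Submission
  imports Defs "HOL-Analysis.Binary_Product_Measure"
begin

text \<open>Howe's method. The Howe closure \<open>H\<close> of the open extension of a simulation \<open>R\<close> is compatible and
  closed under substitution of related values by construction; the point is that it is again a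
  simulation, so that it is contained in similarity. This is proved by induction on the fuel of a
  big-step evaluator whose limit is the given semantics: if \<open>M\<close> and \<open>N\<close> are related by \<open>H\<close>, then every
  finite evaluation of \<open>M\<close> puts at most as much mass on a set \<open>X\<close> of values as the semantics of \<open>N\<close>
  puts on \<open>H(X)\<close>. Evaluation is built from sequencing of distributions, and this comparison of
  distributions is preserved by sequencing because of the layer-cake formula. For bisimilarity, the
  transitive closure of \<open>H\<close> is moreover symmetric, and symmetric simulations are exactly the
  bisimulations.\<close>


section \<open>Sums of extended nonnegative reals\<close>

text \<open>Derivations of the given semantics follow single steps and may be cut off anywhere, so
  they do not decompose along the constructors of a term, whereas the Howe closure does. Evaluating
  with fuel puts the evaluation of subterms and of contracta under one induction hypothesis. Only
  the left-hand term gets fuel: the open extension of \<open>R\<close> compares limits, so the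
  right-hand term must be measured by its full semantics throughout. Three mismatches shape the
  rest. Simulations are required to be preorders, but the Howe closure is not visibly transitive;
  the simulation clause is therefore studied without transitivity and carried over to transitive
  closures. The closure appends \<open>R\<close> on the right only, so it loses symmetry, which
  returns only after transitive closure. Finally, a value occurs both as a term state and as a value
  state, and the argument must pass from related value states to related term states. A simulation
  in general does not allow this, but the largest ones do.\<close>

lemma nn_integral_count_space_SUP_finite:
  fixes f :: "'a::countable \<Rightarrow> ennreal"
  shows "(\<integral>\<^sup>+x. f x \<partial>count_space A) = (SUP F\<in>{F. finite F \<and> F \<subseteq> A}. sum f F)"
proof (rule antisym)
  \<comment> \<open>Countability gives an increasing sequence of finite sets exhausting
    \<open>A\<close>, the elements of code at most \<open>n\<close>. All finite subsets together
    form only a net, to which monotone convergence does not apply.\<close>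
  define S where "S n = {x \<in> A. to_nat x \<le> n}" for n
  have fin: "finite (S n)" for n
    by (rule finite_subset[of _ "to_nat -` {..n}"]) (auto simp: S_def intro: finite_vimageI)
  have "(\<integral>\<^sup>+x. f x \<partial>count_space A) = (\<integral>\<^sup>+x. (SUP n. f x * indicator (S n) x) \<partial>count_space A)"
  proof (intro nn_integral_cong antisym)
    fix x assume "x \<in> space (count_space A)"
    then have "f x = f x * indicator (S (to_nat x)) x" by (simp add: S_def)
    then show "f x \<le> (SUP n. f x * indicator (S n) x)" by (metis SUP_upper UNIV_I)
    show "(SUP n. f x * indicator (S n) x) \<le> f x"
      by (rule SUP_least) (auto split: split_indicator)
  qed
  also have "\<dots> = (SUP n. \<integral>\<^sup>+x. f x * indicator (S n) x \<partial>count_space A)"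
    by (rule nn_integral_monotone_convergence_SUP)
      (auto simp: incseq_def le_fun_def S_def split: split_indicator)
  also have "\<dots> = (SUP n. sum f (S n))"
  proof (intro SUP_cong refl)
    fix n
    have "(\<integral>\<^sup>+x. f x * indicator (S n) x \<partial>count_space A) = (\<Sum>x\<in>S n. f x * indicator (S n) x)"
      by (rule nn_integral_count_space'[OF fin]) (auto simp: S_def)
    then show "(\<integral>\<^sup>+x. f x * indicator (S n) x \<partial>count_space A) = sum f (S n)" by simp
  qed
  also have "\<dots> \<le> (SUP F\<in>{F. finite F \<and> F \<subseteq> A}. sum f F)"
  proof (rule SUP_mono)
    have "S n \<subseteq> A" for n by (auto simp: S_def)
    then show "\<exists>F\<in>{F. finite F \<and> F \<subseteq> A}. sum f (S n) \<le> sum f F" for n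
      using fin by blast
  qed
  finally show "(\<integral>\<^sup>+x. f x \<partial>count_space A) \<le> (SUP F\<in>{F. finite F \<and> F \<subseteq> A}. sum f F)" .
  show "(SUP F\<in>{F. finite F \<and> F \<subseteq> A}. sum f F) \<le> (\<integral>\<^sup>+x. f x \<partial>count_space A)"
  proof (rule SUP_least, clarify)
    fix F assume F: "finite F" "F \<subseteq> A"
    have "sum f F = (\<integral>\<^sup>+x. f x * indicator F x \<partial>count_space A)"
      by (subst nn_integral_count_space'[of F]) (use F in auto)
    also have "\<dots> \<le> (\<integral>\<^sup>+x. f x \<partial>count_space A)"
      by (rule nn_integral_mono) (auto split: split_indicator)
    finally show "sum f F \<le> (\<integral>\<^sup>+x. f x \<partial>count_space A)" .
  qed
qed

text \<open>For nonnegative terms both sides are the supremum of the finite partial sums. Sums are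
  traded for integrals in order to use Tonelli's theorem and monotone convergence.\<close>

lemma infsum_eq_nn_integral_count_space:
  fixes f :: "'a::countable \<Rightarrow> ennreal"
  shows "infsum f A = (\<integral>\<^sup>+x. f x \<partial>count_space A)"
  by (simp add: nn_integral_count_space_SUP_finite nonneg_infsum_complete)

lemma nn_integral_count_space_mono_set:
  "A \<subseteq> B \<Longrightarrow> (\<integral>\<^sup>+x. f x \<partial>count_space A) \<le> (\<integral>\<^sup>+x. f x \<partial>count_space B)"
  by (auto simp: nn_integral_count_space_indicator intro!: nn_integral_mono split: split_indicator)

section \<open>Unit and bind of discrete distributions\<close>

definition dirac :: "'a \<Rightarrow> 'a \<Rightarrow> ennreal" where
  "dirac x = (\<lambda>y. if y = x then 1 else 0)"

text \<open>Kleisli extension of the distribution monad. With values in the extended nonnegative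
  reals it needs neither summability nor a bound on the total mass.\<close>

definition bind_dist :: "('a \<Rightarrow> ennreal) \<Rightarrow> ('a \<Rightarrow> 'b \<Rightarrow> ennreal) \<Rightarrow> 'b \<Rightarrow> ennreal" where
  "bind_dist D f y = (\<integral>\<^sup>+x. D x * f x y \<partial>count_space UNIV)"

lemma nn_integral_dirac: "(\<integral>\<^sup>+y. dirac x y \<partial>count_space X) = indicator X x"
proof -
  have "(\<integral>\<^sup>+y. dirac x y \<partial>count_space X) = (\<Sum>y\<in>X \<inter> {x}. dirac x y)"
    by (rule nn_integral_count_space') (auto simp: dirac_def)
  also have "\<dots> = indicator X x" by (cases "x \<in> X") (auto simp: dirac_def)
  finally show ?thesis .
qed

lemma bind_dirac [simp]: "bind_dist (dirac x) f = f x"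
proof
  fix y
  have "bind_dist (dirac x) f y = (\<Sum>z\<in>{x}. dirac x z * f z y)"
    unfolding bind_dist_def by (rule nn_integral_count_space') (auto simp: dirac_def)
  then show "bind_dist (dirac x) f y = f x y" by (simp add: dirac_def)
qed

lemma bind_zero [simp]: "bind_dist (\<lambda>_. 0) f = (\<lambda>_. 0)"
  by (simp add: bind_dist_def fun_eq_iff)

lemma bind_mono: "D \<le> D' \<Longrightarrow> (\<And>x. f x \<le> f' x) \<Longrightarrow> bind_dist D f \<le> bind_dist D' f'"
  by (auto simp: bind_dist_def le_fun_def intro!: nn_integral_mono mult_mono)

lemma bind_nonzeroE:
  assumes "bind_dist D f y \<noteq> 0"
  obtains x where "D x \<noteq> 0" "f x y \<noteq> 0"
  using assms by (force simp: bind_dist_def nn_integral_0_iff_AE AE_count_space)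

lemma bind_sum_list:
  "(\<Sum>z\<leftarrow>zs. c * bind_dist (D z) f y) = bind_dist (\<lambda>x. \<Sum>z\<leftarrow>zs. c * D z x) f y"
proof (induction zs)
  case (Cons z zs)
  have "c * bind_dist (D z) f y = (\<integral>\<^sup>+x. c * D z x * f x y \<partial>count_space UNIV)"
    by (simp add: bind_dist_def nn_integral_cmult[symmetric] mult.assoc)
  with Cons show ?case
    by (simp add: bind_dist_def nn_integral_add[symmetric] distrib_right)
qed (simp add: bind_dist_def)

text \<open>Joint continuity along one shared index. This is why all recursive calls of the
  evaluator get the same fuel: the limits for all parts of a term are then taken at once.\<close>

lemma bind_SUP:
  assumes D: "incseq D" and f: "\<And>x. incseq (\<lambda>n. f n x)"
  shows "bind_dist (\<lambda>x. SUP n. D n x) (\<lambda>x y. SUP n. f n x y) y = (SUP n::nat. bind_dist (D n) (f n) y)"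
proof -
  have "(SUP n. D n x) * (SUP n. f n x y) = (SUP n. D n x * f n x y)" for x
  proof (rule antisym)
    \<comment> \<open>Both factors increase, so the product of the suprema is already reached on the
      diagonal.\<close>
    have "D m x * f n x y \<le> D (max m n) x * f (max m n) x y" for m n
      using D f[of x] by (auto simp: incseq_def le_fun_def intro!: mult_mono)
    then show "(SUP n. D n x) * (SUP n. f n x y) \<le> (SUP n. D n x * f n x y)"
      unfolding SUP_mult_left_ennreal SUP_mult_right_ennreal
      by (intro SUP_least) (meson SUP_upper UNIV_I order_trans)
    show "(SUP n. D n x * f n x y) \<le> (SUP n. D n x) * (SUP n. f n x y)"
      by (intro SUP_least mult_mono SUP_upper) auto
  qed
  then have "bind_dist (\<lambda>x. SUP n. D n x) (\<lambda>x y. SUP n. f n x y) y =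
    (\<integral>\<^sup>+x. (SUP n. D n x * f n x y) \<partial>count_space UNIV)"
    by (simp add: bind_dist_def)
  also have "\<dots> = (SUP n. \<integral>\<^sup>+x. D n x * f n x y \<partial>count_space UNIV)"
    by (rule nn_integral_monotone_convergence_SUP)
      (use D f in \<open>auto simp: incseq_def le_fun_def intro!: mult_mono\<close>)
  finally show ?thesis by (simp add: bind_dist_def)
qed

text \<open>Tonelli's theorem for counting measures; the indicator of \<open>Y\<close> extends the
  outer sum to the whole type.\<close>

lemma nn_integral_bind:
  "(\<integral>\<^sup>+y. bind_dist D f y \<partial>count_space Y) =
    (\<integral>\<^sup>+x. D x * (\<integral>\<^sup>+y. f x y \<partial>count_space Y) \<partial>count_space UNIV)"
proof -
  have "(\<integral>\<^sup>+y. bind_dist D f y \<partial>count_space Y) =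
    (\<integral>\<^sup>+y. \<integral>\<^sup>+x. (\<lambda>(x, y). D x * f x y * indicator Y y) (x, y) \<partial>count_space UNIV \<partial>count_space UNIV)"
    by (simp add: bind_dist_def nn_integral_count_space_indicator nn_integral_multc[symmetric])
  also have "\<dots> =
    (\<integral>\<^sup>+x. \<integral>\<^sup>+y. (\<lambda>(x, y). D x * f x y * indicator Y y) (x, y) \<partial>count_space UNIV \<partial>count_space UNIV)"
    unfolding nn_integral_fst_count_space nn_integral_snd_count_space ..
  also have "\<dots> = (\<integral>\<^sup>+x. D x * (\<integral>\<^sup>+y. f x y \<partial>count_space Y) \<partial>count_space UNIV)"
    by (simp add: nn_integral_count_space_indicator nn_integral_cmult[symmetric] mult.assoc)
  finally show ?thesis .
qed


section \<open>Lifting relations to distributions\<close>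

text \<open>The Larsen-Skou clause for a single label, detached from states. \<open>R\<close> may
  relate different types and need be neither reflexive nor transitive, so the clause makes sense for
  the Howe closure itself.\<close>

definition lift :: "('a \<times> 'b) set \<Rightarrow> ('a \<Rightarrow> ennreal) \<Rightarrow> ('b \<Rightarrow> ennreal) \<Rightarrow> bool" where
  "lift R D E \<longleftrightarrow> (\<forall>X. (\<integral>\<^sup>+x. D x \<partial>count_space X) \<le> (\<integral>\<^sup>+y. E y \<partial>count_space (R `` X)))"

lemma liftD: "lift R D E \<Longrightarrow> (\<integral>\<^sup>+x. D x \<partial>count_space X) \<le> (\<integral>\<^sup>+y. E y \<partial>count_space (R `` X))"
  by (simp add: lift_def)

lemma lift_mono: "lift R D E \<Longrightarrow> R \<subseteq> S \<Longrightarrow> lift S D E"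
  unfolding lift_def
  by (meson Image_mono nn_integral_count_space_mono_set order_refl order_trans)

lemma lift_trans: "lift R D E \<Longrightarrow> lift S E F \<Longrightarrow> lift (R O S) D F"
  unfolding lift_def relcomp_Image by (meson order_trans)

lemma lift_zero: "lift R (\<lambda>_. 0) E"
  by (simp add: lift_def)

lemma lift_dirac: "(x, y) \<in> R \<Longrightarrow> lift R (dirac x) (dirac y)"
  by (auto simp: lift_def nn_integral_dirac split: split_indicator)

lemma lift_SUP:
  assumes "incseq D" "\<And>n::nat. lift R (D n) E"
  shows "lift R (\<lambda>x. SUP n. D n x) E"
  using assms by (auto simp: lift_def nn_integral_monotone_convergence_SUP intro!: SUP_least)

lemma lift_convex:
  assumes "lift R D E" "lift R D' E'"
  shows "lift R (\<lambda>x. c * D x + c' * D' x) (\<lambda>y. c * E y + c' * E' y)"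
  using assms by (auto simp: lift_def nn_integral_add nn_integral_cmult intro!: add_mono mult_left_mono)

text \<open>A finite form of the layer-cake formula: peel off the smallest value \<open>c\<close> of \<open>\<phi>\<close> on \<open>S\<close>,
  for which the hypothesis on the whole of \<open>S\<close> is used, and continue with \<open>\<phi> - c\<close>. It replaces
  the probability assignments that a max-flow min-cut argument would provide.\<close>

lemma lift_sum_le:
  fixes D :: "'a \<Rightarrow> ennreal"
  assumes "finite S" "lift R D E" "\<And>x y. x \<in> S \<Longrightarrow> (x, y) \<in> R \<Longrightarrow> \<phi> x \<le> \<psi> y"
  shows "(\<Sum>x\<in>S. D x * \<phi> x) \<le> (\<integral>\<^sup>+y. E y * \<psi> y \<partial>count_space UNIV)"
  using assms(1,3)
proof (induction S arbitrary: \<phi> \<psi> rule: finite_psubset_induct)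
  case (psubset S)
  show ?case
  proof (cases "S = {}")
    case False
    define c where "c = Min (\<phi> ` S)"
    have c_le: "c \<le> \<phi> x" if "x \<in> S" for x using that psubset.hyps by (simp add: c_def)
    have "c \<in> \<phi> ` S" unfolding c_def using psubset.hyps False by (intro Min_in) auto
    then obtain x0 where x0: "x0 \<in> S" "\<phi> x0 = c" by auto
    define ind :: "'b \<Rightarrow> ennreal" where "ind = indicator (R `` S)"
    have S: "sum D S \<le> (\<integral>\<^sup>+y. E y * ind y \<partial>count_space UNIV)"
      using liftD[OF assms(2), of S] psubset.hyps
      by (simp add: nn_integral_count_space_finite nn_integral_count_space_indicator ind_def)
    have ge: "c * ind y \<le> \<psi> y" for y
      using psubset.prems c_le by (fastforce simp: ind_def split: split_indicator)
    show ?thesis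
    \<comment> \<open>In the extended nonnegative reals \<open>top - top\<close> is
      \<open>top\<close>, so only a finite minimum can be peeled off. If it is infinite,
      \<open>\<phi>\<close> is infinite on all of \<open>S\<close> and the bound for the whole of
      \<open>S\<close> suffices.\<close>
    proof (cases "c = top")
      case True
      then have "(\<Sum>x\<in>S. D x * \<phi> x) = c * sum D S"
        using c_le by (auto simp: sum_distrib_left mult.commute top_unique intro!: sum.cong)
      also have "\<dots> \<le> (\<integral>\<^sup>+y. c * (E y * ind y) \<partial>count_space UNIV)"
        by (simp add: nn_integral_cmult S mult_left_mono)
      also have "\<dots> \<le> (\<integral>\<^sup>+y. E y * \<psi> y \<partial>count_space UNIV)"
        by (intro nn_integral_mono) (metis ge mult.left_commute mult_left_mono zero_le)
      finally show ?thesis .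
    next
      case c_fin: False
      define \<psi>' where "\<psi>' y = (\<psi> y - c) * ind y" for y
      \<comment> \<open>The minimum is attained at \<open>x0\<close>, whose term vanishes once
        \<open>c\<close> is subtracted; what remains is a sum over a proper subset.\<close>
      have IH: "(\<Sum>x\<in>S - {x0}. D x * (\<phi> x - c)) \<le> (\<integral>\<^sup>+y. E y * \<psi>' y \<partial>count_space UNIV)"
        using x0 psubset.prems
        by (intro psubset.IH) (auto simp: \<psi>'_def ind_def intro!: ennreal_minus_mono split: split_indicator)
      have "(\<Sum>x\<in>S. D x * \<phi> x) = (\<Sum>x\<in>S. D x * (\<phi> x - c) + c * D x)"
        using c_le by (intro sum.cong refl)
          (metis diff_add_cancel_ennreal distrib_left mult.commute)
      also have "\<dots> = (\<Sum>x\<in>S. D x * (\<phi> x - c)) + c * sum D S"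
        by (simp add: sum.distrib sum_distrib_left)
      also have "(\<Sum>x\<in>S. D x * (\<phi> x - c)) = (\<Sum>x\<in>S - {x0}. D x * (\<phi> x - c))"
        using x0 psubset.hyps c_fin by (simp add: sum.remove[of S x0] less_top)
      also have "\<dots> + c * sum D S \<le>
          (\<integral>\<^sup>+y. E y * \<psi>' y \<partial>count_space UNIV) + c * (\<integral>\<^sup>+y. E y * ind y \<partial>count_space UNIV)"
        by (intro add_mono IH mult_left_mono S) simp
      also have "\<dots> = (\<integral>\<^sup>+y. E y * (\<psi>' y + c * ind y) \<partial>count_space UNIV)"
        by (simp add: nn_integral_cmult[symmetric] nn_integral_add[symmetric] distrib_left
            mult.left_commute)
      also have "\<dots> \<le> (\<integral>\<^sup>+y. E y * \<psi> y \<partial>count_space UNIV)"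
      proof (intro nn_integral_mono mult_left_mono)
        fix y
        show "\<psi>' y + c * ind y \<le> \<psi> y"
          using ge[of y] by (cases "y \<in> R `` S") (simp_all add: \<psi>'_def ind_def diff_add_cancel_ennreal)
      qed simp
      finally show ?thesis .
    qed
  qed simp
qed

text \<open>The mass of \<open>f x\<close> on \<open>X\<close> and the mass of \<open>g y\<close> on
  the \<open>S\<close>-image of \<open>X\<close> are the weights \<open>\<phi>\<close> and
  \<open>\<psi>\<close> of the layer-cake inequality. Countability of \<open>'a\<close> reduces the
  sum over intermediate results to the finite sums for which it is proved.\<close>

lemma lift_bind:
  fixes D :: "'a::countable \<Rightarrow> ennreal"
  assumes "lift R D E" "\<And>x y. (x, y) \<in> R \<Longrightarrow> lift S (f x) (g y)"
  shows "lift S (bind_dist D f) (bind_dist E g)"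
  unfolding lift_def
proof
  fix X
  have "(\<integral>\<^sup>+y. bind_dist D f y \<partial>count_space X) =
    (\<integral>\<^sup>+x. D x * (\<integral>\<^sup>+y. f x y \<partial>count_space X) \<partial>count_space UNIV)"
    by (rule nn_integral_bind)
  also have "\<dots> \<le> (\<integral>\<^sup>+x. E x * (\<integral>\<^sup>+y. g x y \<partial>count_space (S `` X)) \<partial>count_space UNIV)"
    unfolding nn_integral_count_space_SUP_finite[where f="\<lambda>x. D x * _ x"]
    by (rule SUP_least) (auto intro!: lift_sum_le[OF _ assms(1)] liftD[OF assms(2)])
  also have "\<dots> = (\<integral>\<^sup>+y. bind_dist E g y \<partial>count_space (S `` X))"
    by (rule nn_integral_bind[symmetric])
  finally show "(\<integral>\<^sup>+y. bind_dist D f y \<partial>count_space X) \<le> \<dots>" .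
qed


section \<open>A fuel-indexed evaluator\<close>

instance tm :: (countable) countable
  by countable_datatype

instance ty :: countable
  by countable_datatype

instance state :: (countable) countable
  by countable_datatype

text \<open>The junk value \<open>Var 0\<close> is a stuck term: it evaluates to the empty distribution.\<close>

fun beta :: "'op tm \<Rightarrow> 'op tm \<Rightarrow> 'op tm" where
  "beta (Lam x M) W = subst [x \<mapsto> W] M"
| "beta (Fix x M) W = App (subst [x \<mapsto> Fix x M] M) W"
| "beta _ _ = Var 0"

fun delta :: "'op::operators \<Rightarrow> 'op tm \<Rightarrow> 'op tm \<Rightarrow> 'op tm" where
  "delta f (Num m) (Num n) = op_apply (interp f) m n"
| "delta f _ _ = Var 0"

fun fst_of :: "'op tm \<Rightarrow> 'op tm" where
  "fst_of (PairT M N) = M"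
| "fst_of _ = Var 0"

fun snd_of :: "'op tm \<Rightarrow> 'op tm" where
  "snd_of (PairT M N) = N"
| "snd_of _ = Var 0"

fun branch :: "'op tm \<Rightarrow> 'op tm \<Rightarrow> 'op tm \<Rightarrow> 'op tm" where
  "branch (Bool b) M N = (if b then M else N)"
| "branch _ _ _ = Var 0"

text \<open>What a case construct does once its scrutinee is a value. Cons cells are lazy, so head
  and tail are evaluated only here. The evaluator \<open>e\<close> is a parameter because both
  \<open>ev n\<close> and \<open>sem\<close> are used for it.\<close>

fun unfold_list :: "'op tm \<Rightarrow> ('op tm \<Rightarrow> 'op tm \<Rightarrow> ennreal) \<Rightarrow> 'op tm \<Rightarrow> ('op tm \<Rightarrow> 'op tm \<Rightarrow> 'op tm) \<Rightarrow>
    'op tm \<Rightarrow> ennreal" where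
  "unfold_list NilT e M F = e M"
| "unfold_list (ConsT A B) e M F = bind_dist (e A) (\<lambda>V. bind_dist (e B) (\<lambda>W. e (F V W)))"
| "unfold_list _ e M F = (\<lambda>_. 0)"

text \<open>Fuel bounds the depth of the evaluation tree, not the length of a run. Contracta are
  charged like subterms, so the recursion is primitive although substitution may enlarge a term.
  Values are tested first, so that lazy pairs and lists are returned unevaluated.\<close>

primrec ev :: "nat \<Rightarrow> 'op::operators tm \<Rightarrow> 'op tm \<Rightarrow> ennreal" where
  "ev 0 M = (\<lambda>_. 0)"
| "ev (Suc n) M = (if is_value M then dirac M else case M of
      Choice M N \<Rightarrow> (\<lambda>V. 1 / 2 * ev n M V + 1 / 2 * ev n N V)
    | IfT L M N \<Rightarrow> bind_dist (ev n L) (\<lambda>V. ev n (branch V M N))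
    | OpT f M N \<Rightarrow> bind_dist (ev n M) (\<lambda>V. bind_dist (ev n N) (\<lambda>W. ev n (delta f V W)))
    | Fst M \<Rightarrow> bind_dist (ev n M) (\<lambda>V. ev n (fst_of V))
    | Snd M \<Rightarrow> bind_dist (ev n M) (\<lambda>V. ev n (snd_of V))
    | CaseT L M h t N \<Rightarrow>
        bind_dist (ev n L) (\<lambda>V. unfold_list V (ev n) M (\<lambda>V W. subst [h \<mapsto> V, t \<mapsto> W] N))
    | App M N \<Rightarrow> bind_dist (ev n M) (\<lambda>V. bind_dist (ev n N) (\<lambda>W. ev n (beta V W)))
    | _ \<Rightarrow> (\<lambda>_. 0))"

lemma ev_Suc [simp]:
  "is_value V \<Longrightarrow> ev (Suc n) V = dirac V"
  "ev (Suc n) (Choice M N) = (\<lambda>V. 1 / 2 * ev n M V + 1 / 2 * ev n N V)"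
  "ev (Suc n) (IfT L M N) = bind_dist (ev n L) (\<lambda>V. ev n (branch V M N))"
  "ev (Suc n) (OpT f M N) = bind_dist (ev n M) (\<lambda>V. bind_dist (ev n N) (\<lambda>W. ev n (delta f V W)))"
  "ev (Suc n) (Fst M) = bind_dist (ev n M) (\<lambda>V. ev n (fst_of V))"
  "ev (Suc n) (Snd M) = bind_dist (ev n M) (\<lambda>V. ev n (snd_of V))"
  "ev (Suc n) (CaseT L M h t N) =
     bind_dist (ev n L) (\<lambda>V. unfold_list V (ev n) M (\<lambda>V W. subst [h \<mapsto> V, t \<mapsto> W] N))"
  "ev (Suc n) (App M N) = bind_dist (ev n M) (\<lambda>V. bind_dist (ev n N) (\<lambda>W. ev n (beta V W)))"
  by simp_all

declare ev.simps(2) [simp del]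

lemma ev_Var [simp]: "ev n (Var x) = (\<lambda>_. 0)"
  by (cases n) (auto simp: ev.simps(2))

lemma unfold_list_mono: "(\<And>X. e X \<le> e' X) \<Longrightarrow> unfold_list V e M F \<le> unfold_list V e' M F"
  by (cases V) (auto intro!: bind_mono)

lemma ev_Suc_mono:
  fixes M :: "'op::operators tm"
  shows "ev n M \<le> ev (Suc n) M"
proof (induction n arbitrary: M)
  case (Suc n)
  have "ev (Suc n) (Choice A B) \<le> ev (Suc (Suc n)) (Choice A B)" for A B :: "'op tm"
    using Suc[of A] Suc[of B] unfolding ev_Suc(2) le_fun_def by (intro allI add_mono mult_left_mono) auto
  then show ?case
    by (subst (1 2) ev.simps(2), cases M) (simp_all add: bind_mono unfold_list_mono Suc)
qed (simp add: le_fun_def)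

lemma incseq_ev: "incseq (\<lambda>n. ev n M)"
  by (intro incseq_SucI ev_Suc_mono)

lemma ev_mono: "m \<le> n \<Longrightarrow> ev m M \<le> ev n M"
  using incseqD[OF incseq_ev] .

lemma ev_le: "m \<le> n \<Longrightarrow> ev m M V \<le> ev n M V"
  using ev_mono by (auto simp: le_fun_def)


subsection \<open>Agreement with the small-step semantics\<close>

lemma evctx_compose: "evctx E \<Longrightarrow> evctx F \<Longrightarrow> evctx (\<lambda>X. E (F X))"
  by (induction E rule: evctx.induct) (auto intro: evctx.intros)

lemmas evctx_frames =
  evctx.intros(2)[OF evctx.intros(1)] evctx.intros(3)[OF _ evctx.intros(1)]
  evctx.intros(4)[OF evctx.intros(1)] evctx.intros(5)[OF _ evctx.intros(1)]
  evctx.intros(6-10)[OF evctx.intros(1)] evctx.intros(11)[OF _ evctx.intros(1)]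

lemma step_evctx: "step M Ns \<Longrightarrow> evctx E \<Longrightarrow> step (E M) (map E Ns)"
  by (auto elim!: step.cases simp: comp_def intro: step.intros[OF _ evctx_compose, of _ _ E, simplified comp_def])

text \<open>Derivations for the terms \<open>E V\<close> are grafted onto the leaves of a derivation
  for \<open>M\<close> placed inside \<open>E\<close>; leaves cut off by the empty rule stay empty.
  Averaging commutes with grafting because bind is linear in its first argument.\<close>

lemma approx_bind:
  assumes "approx M D" "evctx E" and F: "\<And>V. is_value V \<Longrightarrow> approx (E V) (F V)"
  shows "approx (E M) (bind_dist D F)"
  using assms(1)
proof induction
  case (approx_value V)
  then show ?case using F[of V] bind_dirac[of V F] by (simp add: dirac_def)
next
  case (approx_step M Ns Ds)
  have "list_all2 approx (map E Ns) (map (\<lambda>D. bind_dist D F) Ds)"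
    using approx_step.IH by (auto simp: list_all2_conv_all_nth)
  from approx.approx_step[OF step_evctx[OF approx_step.hyps \<open>evctx E\<close>] this]
  show ?case by (simp add: bind_sum_list comp_def)
qed (simp add: approx_empty)

lemma approx_redex:
  assumes "redex M [N]" "approx N D" shows "approx M D"
proof -
  have "step M [N]" using step.intros[OF assms(1) evctx.intros(1)] by simp
  from approx_step[OF this, of "[D]"] assms(2) show ?thesis by simp
qed

text \<open>Evaluation with fuel is assembled by grafting along the evaluation frames of a
  construct, followed by one contraction. Every redex except choice has a single successor.\<close>

lemma approx_ev:
  fixes M :: "'op::operators tm"
  shows "approx M (ev n M)"
proof (induction n arbitrary: M)
  case (Suc n)
  note bnd = approx_bind[OF Suc]
  show ?case
  proof (cases "is_value M")
    case True
    then show ?thesis using approx_value[OF True] by (simp add: dirac_def)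
  next
    case False
    show ?thesis
    proof (cases M)
      case (Choice A B)
      have "step (Choice A B) [A, B]" using step.intros[OF redex.intros(10) evctx.intros(1)] by simp
      from approx_step[OF this, of "[ev n A, ev n B]"] Suc Choice show ?thesis by simp
    next
      case (IfT L A B)
      \<comment> \<open>If no rule applies, the continuation is the stuck \<open>Var 0\<close> of
        mass zero, and the zero distribution approximates every term.\<close>
      have "approx (IfT V A B) (ev n (branch V A B))" for V
        by (cases V) (auto intro: approx_redex redex.intros Suc approx_empty)
      then show ?thesis
        using IfT bnd[OF evctx_frames(7)] by simp
    next
      case (OpT f A B)
      have "approx (OpT f V W) (ev n (delta f V W))" for V W
        by (cases "(f, V, W)" rule: delta.cases) (auto intro: approx_redex redex.intros Suc approx_empty)
      then have "approx (OpT f V B) (bind_dist (ev n B) (\<lambda>W. ev n (delta f V W)))" if "is_value V" for V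
        using that bnd[OF evctx_frames(4)] by simp
      then show ?thesis
        using OpT bnd[OF evctx_frames(3)] by simp
    next
      case (Fst A)
      have "approx (Fst V) (ev n (fst_of V))" for V :: "'op tm"
        by (cases V) (auto intro: approx_redex[OF redex.intros(4)] Suc approx_empty)
      then show ?thesis
        using Fst bnd[OF evctx_frames(5)] by simp
    next
      case (Snd A)
      have "approx (Snd V) (ev n (snd_of V))" for V :: "'op tm"
        by (cases V) (auto intro: approx_redex[OF redex.intros(5)] Suc approx_empty)
      then show ?thesis
        using Snd bnd[OF evctx_frames(6)] by simp
    next
      case (CaseT L A h t B)
      let ?F = "\<lambda>V W. subst [h \<mapsto> V, t \<mapsto> W] B"
      \<comment> \<open>The frames of a case construct are discharged from the inside: the tail next
        to an evaluated head, then the head, then the scrutinee.\<close>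
      have "approx (CaseT (ConsT V W) A h t B) (ev n (?F V W))" if "is_value V" "is_value W" for V W
        using that by (auto intro: approx_redex redex.intros Suc)
      then have "approx (CaseT (ConsT V Y) A h t B) (bind_dist (ev n Y) (\<lambda>W. ev n (?F V W)))"
        if "is_value V" for V Y
        using that bnd[OF evctx_frames(10)] by simp
      then have "approx (CaseT (ConsT X Y) A h t B) (bind_dist (ev n X) (\<lambda>V. bind_dist (ev n Y) (\<lambda>W. ev n (?F V W))))"
        for X Y
        using bnd[OF evctx_frames(9)] by simp
      then have "approx (CaseT V A h t B) (unfold_list V (ev n) A ?F)" for V
        by (cases V) (auto intro: approx_redex redex.intros Suc approx_empty)
      then show ?thesis
        using CaseT bnd[OF evctx_frames(8)] by simp
    next
      case (App A B)
      have "approx (App V W) (ev n (beta V W))" if "is_value W" for V W :: "'op tm"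
        using that by (cases V) (auto intro: approx_redex redex.intros Suc approx_empty)
      then have "approx (App V B) (bind_dist (ev n B) (\<lambda>W. ev n (beta V W)))" if "is_value V" for V
        using that bnd[OF evctx_frames(2)] by simp
      then show ?thesis
        using App bnd[OF evctx_frames(1)] by simp
    qed (use False in \<open>auto intro: approx_empty\<close>)
  qed
qed (simp add: approx_empty)

definition avg :: "nat \<Rightarrow> 'op::operators tm list \<Rightarrow> 'op tm \<Rightarrow> ennreal" where
  "avg n Ns V = (\<Sum>N\<leftarrow>Ns. 1 / of_nat (length Ns) * ev n N V)"

lemma avg_0 [simp]: "avg 0 Ns = (\<lambda>_. 0)"
  by (induction Ns) (auto simp: avg_def)

lemma ev_value_le: "is_value V \<Longrightarrow> ev n V \<le> dirac V"
  by (cases n) (auto simp: le_fun_def)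

text \<open>The fuel \<open>k\<close> pays for the frames of \<open>E\<close>, in which evaluation is linear in the distribution of the
  term in the hole.\<close>

definition linear_ctx :: "'op::operators tm \<Rightarrow> 'op tm list \<Rightarrow> ('op tm \<Rightarrow> 'op tm) \<Rightarrow> bool" where
  "linear_ctx M Ns E \<longleftrightarrow> (\<exists>k. \<forall>n. avg n (map E Ns) \<le> ev (n + k) (E M))"

text \<open>\<open>f n\<close> is the continuation of the frame \<open>F\<close> at fuel
  \<open>n\<close>. In \<open>lower\<close> two units of fuel are allowed because a frame that
  already holds a value, such as \<open>App V X\<close>, also has to pay for evaluating
  \<open>V\<close>. Altogether a frame raises the constant \<open>k\<close> by one.\<close>

lemma linear_ctx_frame:
  assumes "linear_ctx M Ns E"
    and f: "\<And>n x. f n x \<le> f (Suc n) x"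
    and upper: "\<And>n X. ev (Suc n) (F X) \<le> bind_dist (ev n X) (f n)"
    and lower: "\<And>n X. bind_dist (ev n X) (f n) \<le> ev (Suc (Suc n)) (F X)"
  shows "linear_ctx M Ns (\<lambda>X. F (E X))"
proof -
  obtain k where k: "\<And>n. avg n (map E Ns) \<le> ev (n + k) (E M)"
    using assms(1) by (auto simp: linear_ctx_def)
  have "avg n (map (\<lambda>X. F (E X)) Ns) \<le> ev (n + Suc k) (F (E M))" for n
  proof (cases n)
    case (Suc m)
    have "(\<Sum>N\<leftarrow>Ns. c * ev (Suc m) (F (E N)) V) \<le> (\<Sum>N\<leftarrow>Ns. c * bind_dist (ev m (E N)) (f m) V)" for c V
      using upper[of m] by (intro sum_list_mono mult_left_mono) (auto simp: le_fun_def)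
    then have "avg (Suc m) (map (\<lambda>X. F (E X)) Ns) \<le> bind_dist (avg m (map E Ns)) (f m)"
      by (simp add: avg_def[abs_def] le_fun_def bind_sum_list[symmetric] comp_def)
    also have "\<dots> \<le> bind_dist (ev (m + k) (E M)) (f (m + k))"
      using lift_Suc_mono_le[of "\<lambda>n. f n _", OF f] by (intro bind_mono k) auto
    also have "\<dots> \<le> ev (Suc (Suc (m + k))) (F (E M))" by (rule lower)
    finally show ?thesis using Suc by simp
  qed (simp add: le_fun_def)
  then show ?thesis unfolding linear_ctx_def by blast
qed

lemma bind_ev_value_le: "is_value V \<Longrightarrow> bind_dist (ev n V) g \<le> g V"
  using bind_mono[OF ev_value_le, of V g g n] by simp

lemma linear_evctx:
  assumes "evctx E" "linear_ctx M Ns (\<lambda>X. X)"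
  shows "linear_ctx M Ns E"
  using assms(1)
proof induction
  case 1
  show ?case by (rule assms(2))
next
  case (2 E B)
  from 2(2) show ?case
    by (rule linear_ctx_frame[where F="\<lambda>X. App X B" and
          f="\<lambda>n V. bind_dist (ev n B) (\<lambda>W. ev n (beta V W))"])
      (simp_all add: bind_mono ev_Suc_mono)
next
  case (3 V E)
  from 3(3) show ?case
    by (rule linear_ctx_frame[where F="\<lambda>X. App V X" and f="\<lambda>n W. ev n (beta V W)"])
      (simp_all add: 3(1) bind_mono ev_Suc_mono
        bind_ev_value_le[where g="\<lambda>V. bind_dist _ (\<lambda>W. ev _ (beta V W))"])
next
  case (4 E f B)
  from 4(2) show ?case
    by (rule linear_ctx_frame[where F="\<lambda>X. OpT f X B" and
          f="\<lambda>n V. bind_dist (ev n B) (\<lambda>W. ev n (delta f V W))"])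
      (simp_all add: bind_mono ev_Suc_mono)
next
  case (5 V E f)
  from 5(3) show ?case
    by (rule linear_ctx_frame[where F="\<lambda>X. OpT f V X" and f="\<lambda>n W. ev n (delta f V W)"])
      (simp_all add: 5(1) bind_mono ev_Suc_mono
        bind_ev_value_le[where g="\<lambda>V. bind_dist _ (\<lambda>W. ev _ (delta f V W))"])
next
  case (6 E)
  from 6(2) show ?case
    by (rule linear_ctx_frame[where F=Fst and f="\<lambda>n V. ev n (fst_of V)"])
      (simp_all add: bind_mono ev_Suc_mono)
next
  case (7 E)
  from 7(2) show ?case
    by (rule linear_ctx_frame[where F=Snd and f="\<lambda>n V. ev n (snd_of V)"])
      (simp_all add: bind_mono ev_Suc_mono)
next
  case (8 E A B)
  from 8(2) show ?case
    by (rule linear_ctx_frame[where F="\<lambda>X. IfT X A B" and f="\<lambda>n V. ev n (branch V A B)"])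
      (simp_all add: bind_mono ev_Suc_mono)
next
  case (9 E A h t B)
  from 9(2) show ?case
    by (rule linear_ctx_frame[where F="\<lambda>X. CaseT X A h t B" and
          f="\<lambda>n V. unfold_list V (ev n) A (\<lambda>V W. subst [h \<mapsto> V, t \<mapsto> W] B)"])
      (simp_all add: bind_mono ev_Suc_mono unfold_list_mono)
next
  case (10 E L A h t B)
  let ?F = "\<lambda>V W. subst [h \<mapsto> V, t \<mapsto> W] B"
  \<comment> \<open>The scrutinee is a cons cell and hence a value, so evaluating it returns it with
    mass at most one; the part that depends on \<open>X\<close> is the evaluation of the
    head.\<close>
  have "bind_dist (ev n (ConsT X L)) (\<lambda>V. unfold_list V (ev n) A ?F) \<le> unfold_list (ConsT X L) (ev n) A ?F" for n X
    by (rule bind_ev_value_le) simp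
  then show ?case
    by (intro linear_ctx_frame[OF 10(2), where F="\<lambda>X. CaseT (ConsT X L) A h t B" and
          f="\<lambda>n V. bind_dist (ev n L) (\<lambda>W. ev n (?F V W))"])
      (simp_all add: bind_mono ev_Suc_mono)
next
  case (11 V E A h t B)
  let ?F = "\<lambda>V W. subst [h \<mapsto> V, t \<mapsto> W] B"
  have "bind_dist (ev n (ConsT V X)) (\<lambda>V. unfold_list V (ev n) A ?F) \<le> unfold_list (ConsT V X) (ev n) A ?F" for n X
    by (rule bind_ev_value_le) simp
  also have "unfold_list (ConsT V X) (ev n) A ?F \<le> bind_dist (ev n X) (\<lambda>W. ev n (?F V W))" for n X
    using bind_ev_value_le[OF 11(1)] by simp
  finally show ?case
    by (intro linear_ctx_frame[OF 11(3), where F="\<lambda>X. CaseT (ConsT V X) A h t B" and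
          f="\<lambda>n W. ev n (?F V W)"])
      (simp_all add: 11(1) bind_mono ev_Suc_mono)
qed

lemma redex_linear: "redex M Ns \<Longrightarrow> linear_ctx M Ns (\<lambda>X. X)"
proof -
  assume "redex M Ns"
  \<comment> \<open>One unit of fuel pays for the contraction, the other for evaluating operands
    that are values already.\<close>
  then have "avg n Ns \<le> ev (Suc (Suc n)) M" for n
  proof cases
    case (10 A B)
    have "avg n [A, B] = ev (Suc n) (Choice A B)" by (simp add: avg_def fun_eq_iff)
    with 10 show ?thesis using ev_Suc_mono by metis
  next
    case (2 V x A)
    then have "ev (Suc (Suc n)) M = ev (Suc n) (App (subst [x \<mapsto> Fix x A] A) V)" by simp
    with 2 show ?thesis by (simp only:) (simp add: avg_def[abs_def] ev_Suc_mono del: ev_Suc)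
  qed (simp_all add: avg_def[abs_def] ev_Suc_mono)
  then show ?thesis unfolding linear_ctx_def by (intro exI[of _ 2]) simp
qed

text \<open>Only an inequality can be expected, since a derivation may stop early on any branch. The
  fuel depends on the derivation, through the depth of the evaluation contexts of its steps.\<close>

lemma approx_le_ev: "approx M D \<Longrightarrow> \<exists>n. D \<le> ev n M"
proof (induction rule: approx.induct)
  case (approx_value V)
  then show ?case by (intro exI[of _ 1]) (simp add: dirac_def)
next
  case (approx_step M Ns Ds)
  obtain A As E where *: "M = E A" "Ns = map E As" "redex A As" "evctx E"
    using approx_step.hyps by (auto elim: step.cases)
  obtain k where k: "\<And>n. avg n Ns \<le> ev (n + k) M"
    using linear_evctx[OF *(4) redex_linear[OF *(3)]] by (auto simp: linear_ctx_def *)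
  \<comment> \<open>A step has finitely many successors and evaluation is monotone in the fuel, so
    the largest fuel serves all of them.\<close>
  have "\<exists>n. list_all2 (\<lambda>N D. D \<le> ev n N) Ns Ds"
    using approx_step.IH
  proof induction
    case (Cons N Ns D Ds)
    then obtain m n where "D \<le> ev m N" "list_all2 (\<lambda>N D. D \<le> ev n N) Ns Ds" by blast
    then have "D \<le> ev (max m n) N" "list_all2 (\<lambda>N D. D \<le> ev (max m n) N) Ns Ds"
      using ev_mono[of m "max m n"] ev_mono[of n "max m n"]
      by (auto intro: order_trans elim!: list_all2_mono)
    then show ?case by auto
  qed auto
  then obtain n where n: "list_all2 (\<lambda>N D. D \<le> ev n N) Ns Ds" by blast
  have "(\<Sum>D\<leftarrow>Ds. c * D V) \<le> (\<Sum>N\<leftarrow>Ns. c * ev n N V)" for c V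
    using n by induction (auto simp: le_fun_def intro!: add_mono mult_left_mono)
  then have "(\<lambda>V. \<Sum>D\<leftarrow>Ds. 1 / of_nat (length Ns) * D V) \<le> avg n Ns"
    by (auto simp: avg_def le_fun_def)
  with k[of n] show ?case by (meson order_trans)
qed (auto simp: le_fun_def)

lemma sem_eq_SUP_ev: "sem M V = (SUP n. ev n M V)"
  unfolding sem_def
proof (rule antisym)
  show "(SUP D\<in>{D. approx M D}. D V) \<le> (SUP n. ev n M V)"
    by (rule SUP_least) (metis SUP_upper2 UNIV_I approx_le_ev le_fun_def mem_Collect_eq)
  show "(SUP n. ev n M V) \<le> (SUP D\<in>{D. approx M D}. D V)"
    by (rule SUP_least) (auto intro!: SUP_upper2[OF _ order_refl] approx_ev)
qed


subsection \<open>Equations for the semantics\<close>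

lemma sem_eq_SUP_ev_Suc: "sem M V = (SUP n. ev (Suc n) M V)"
  unfolding sem_eq_SUP_ev
  by (rule antisym; rule SUP_mono) (auto intro: ev_Suc_mono[THEN le_funD])

lemma sem_fun: "sem M = (\<lambda>V. SUP n. ev n M V)"
  by (simp add: fun_eq_iff sem_eq_SUP_ev)

lemma incseq_bind:
  "incseq D \<Longrightarrow> (\<And>x. incseq (\<lambda>n. f n x)) \<Longrightarrow> incseq (\<lambda>n. bind_dist (D n) (f n))"
  by (auto simp: incseq_def intro!: bind_mono)

lemma incseq_unfold_list:
  "(\<And>X. incseq (\<lambda>n. e n X)) \<Longrightarrow> incseq (\<lambda>n. unfold_list V (e n) M F)"
  by (auto simp: incseq_def intro!: unfold_list_mono)

lemma bind_sem:
  assumes "\<And>x. incseq (\<lambda>n. f n x)"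
  shows "bind_dist (sem M) (\<lambda>x y. SUP n. f n x y) = (\<lambda>y. SUP n. bind_dist (ev n M) (f n) y)"
  by (simp add: sem_fun fun_eq_iff bind_SUP[OF incseq_ev assms])

lemma unfold_list_sem:
  "unfold_list V sem M F = (\<lambda>y. SUP n. unfold_list V (ev n) M F y)"
  by (cases V) (simp_all add: sem_fun[of "F _ _"] bind_sem incseq_ev incseq_bind, simp add: sem_fun)

lemma sem_value: "is_value V \<Longrightarrow> sem V = dirac V"
  by (simp add: fun_eq_iff sem_eq_SUP_ev_Suc)

lemma sem_Choice: "sem (Choice M N) = (\<lambda>V. 1 / 2 * sem M V + 1 / 2 * sem N V)"
proof
  fix V
  have "(SUP n. 1 / 2 * ev n M V + 1 / 2 * ev n N V) =
      (SUP n. 1 / 2 * ev n M V) + (SUP n. 1 / 2 * ev n N V)"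
  proof (rule SUP_add_directed_ennreal)
    show "\<exists>k\<in>UNIV. 1 / 2 * ev i M V + 1 / 2 * ev j N V \<le> 1 / 2 * ev k M V + 1 / 2 * ev k N V" for i j
      by (intro bexI[of _ "max i j"] add_mono mult_left_mono ev_le) auto
  qed
  then show "sem (Choice M N) V = 1 / 2 * sem M V + 1 / 2 * sem N V"
    unfolding sem_eq_SUP_ev_Suc[of "Choice M N"] sem_eq_SUP_ev[of M] sem_eq_SUP_ev[of N]
    by (simp add: SUP_mult_left_ennreal)
qed

text \<open>Passing to the limit in the clauses of \<open>ev\<close>. The right-hand side of the key
  lemma is measured by \<open>sem\<close>, and these equations give it the same bind structure as
  the left-hand side.\<close>

lemma sem_elim:
  "sem (IfT L M N) = bind_dist (sem L) (\<lambda>V. sem (branch V M N))"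
  "sem (OpT f M N) = bind_dist (sem M) (\<lambda>V. bind_dist (sem N) (\<lambda>W. sem (delta f V W)))"
  "sem (Fst M) = bind_dist (sem M) (\<lambda>V. sem (fst_of V))"
  "sem (Snd M) = bind_dist (sem M) (\<lambda>V. sem (snd_of V))"
  "sem (CaseT L M h t N) =
     bind_dist (sem L) (\<lambda>V. unfold_list V sem M (\<lambda>V W. subst [h \<mapsto> V, t \<mapsto> W] N))"
  "sem (App M N) = bind_dist (sem M) (\<lambda>V. bind_dist (sem N) (\<lambda>W. sem (beta V W)))"
  by (simp_all add: fun_eq_iff sem_eq_SUP_ev_Suc[of "IfT L M N"] sem_eq_SUP_ev_Suc[of "OpT f M N"]
      sem_eq_SUP_ev_Suc[of "Fst M"] sem_eq_SUP_ev_Suc[of "Snd M"]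
      sem_eq_SUP_ev_Suc[of "CaseT L M h t N"] sem_eq_SUP_ev_Suc[of "App M N"] unfold_list_sem
      sem_fun[of "branch _ _ _"] sem_fun[of "delta _ _ _"] sem_fun[of "fst_of _"]
      sem_fun[of "snd_of _"] sem_fun[of "beta _ _"]
      bind_sem incseq_ev incseq_bind incseq_unfold_list)


section \<open>Typing and substitution\<close>

inductive_cases typing_elims:
  "\<Gamma> \<turnstile> Var x \<Colon> \<sigma>" "\<Gamma> \<turnstile> Num n \<Colon> \<sigma>" "\<Gamma> \<turnstile> Bool b \<Colon> \<sigma>" "\<Gamma> \<turnstile> NilT \<Colon> \<sigma>" "\<Gamma> \<turnstile> PairT M N \<Colon> \<sigma>"
  "\<Gamma> \<turnstile> ConsT M N \<Colon> \<sigma>" "\<Gamma> \<turnstile> Lam x M \<Colon> \<sigma>" "\<Gamma> \<turnstile> Fix x M \<Colon> \<sigma>" "\<Gamma> \<turnstile> Choice M N \<Colon> \<sigma>"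
  "\<Gamma> \<turnstile> IfT L M N \<Colon> \<sigma>" "\<Gamma> \<turnstile> OpT f M N \<Colon> \<sigma>" "\<Gamma> \<turnstile> Fst M \<Colon> \<sigma>" "\<Gamma> \<turnstile> Snd M \<Colon> \<sigma>"
  "\<Gamma> \<turnstile> CaseT L M h t N \<Colon> \<sigma>" "\<Gamma> \<turnstile> App M N \<Colon> \<sigma>"

lemma fmsubset_lookup: "\<Gamma> \<subseteq>\<^sub>f \<Delta> \<longleftrightarrow> (\<forall>x \<tau>. fmlookup \<Gamma> x = Some \<tau> \<longrightarrow> fmlookup \<Delta> x = Some \<tau>)"
  by (auto simp: fmsubset_alt_def fmpred_iff)

lemma fmsubset_upd: "\<Gamma> \<subseteq>\<^sub>f \<Delta> \<Longrightarrow> fmupd x \<sigma> \<Gamma> \<subseteq>\<^sub>f fmupd x \<sigma> \<Delta>"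
  by (simp add: fmsubset_lookup)

lemma typing_weaken: "\<Gamma> \<turnstile> M \<Colon> \<sigma> \<Longrightarrow> \<Gamma> \<subseteq>\<^sub>f \<Delta> \<Longrightarrow> \<Delta> \<turnstile> M \<Colon> \<sigma>"
proof (induction arbitrary: \<Delta> rule: typing.induct)
  case (ty_Var \<Gamma> x \<sigma>)
  then show ?case by (auto simp: fmsubset_lookup intro: typing.ty_Var)
next
  case (ty_App \<Gamma> M \<sigma> \<tau> N)
  then show ?case using typing.ty_App by metis
next
  case (ty_Case \<Gamma> L \<sigma> M \<tau> h t N)
  then show ?case using typing.ty_Case fmsubset_upd by metis
qed (auto intro: typing.intros fmsubset_upd)

lemma closed_typing: "fmempty \<turnstile> M \<Colon> \<sigma> \<Longrightarrow> \<Gamma> \<turnstile> M \<Colon> \<sigma>"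
  by (erule typing_weaken) (simp add: fmsubset_lookup)

text \<open>Weakening is the case where \<open>\<theta>\<close> is empty.\<close>

definition typed_subst :: "tyenv \<Rightarrow> (var \<rightharpoonup> 'op::operators tm) \<Rightarrow> tyenv \<Rightarrow> bool" where
  "typed_subst \<Gamma> \<theta> \<Delta> \<longleftrightarrow> (\<forall>x \<tau>. fmlookup \<Gamma> x = Some \<tau> \<longrightarrow>
     (\<theta> x = None \<longrightarrow> fmlookup \<Delta> x = Some \<tau>) \<and> (\<forall>V. \<theta> x = Some V \<longrightarrow> V \<in> closed_values \<tau>))"

lemma typed_subst_upd:
  "typed_subst \<Gamma> \<theta> \<Delta> \<Longrightarrow> typed_subst (fmupd x \<sigma> \<Gamma>) (\<theta>(x := None)) (fmupd x \<sigma> \<Delta>)"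
  by (auto simp: typed_subst_def)

lemma typed_substD:
  assumes "typed_subst \<Gamma> \<theta> \<Delta>" "fmlookup \<Gamma> x = Some \<tau>"
  shows "\<theta> x = None \<Longrightarrow> fmlookup \<Delta> x = Some \<tau>" "\<theta> x = Some V \<Longrightarrow> V \<in> closed_values \<tau>"
  using assms by (auto simp: typed_subst_def)

lemma closing_typed_subst:
  assumes "closing_subst \<Gamma> \<theta>"
  shows "typed_subst \<Gamma> \<theta> fmempty"
proof -
  have "rel_option (\<lambda>\<tau> V. V \<in> closed_values \<tau>) (fmlookup \<Gamma> x) (\<theta> x)" for x
    using assms by (simp add: closing_subst_def)
  then show ?thesis unfolding typed_subst_def by (metis option.rel_distinct(2) option.rel_inject(2))
qed

text \<open>This permits cutting a substitution down to the domain of an environment, outside of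
  which closing substitutions must be undefined. For the empty environment it shows that closed
  terms are unaffected.\<close>

lemma subst_cong:
  "\<Gamma> \<turnstile> M \<Colon> \<sigma> \<Longrightarrow> \<forall>x\<in>fmdom' \<Gamma>. \<theta> x = \<theta>' x \<Longrightarrow> subst \<theta> M = subst \<theta>' M"
proof (induction arbitrary: \<theta> \<theta>' rule: typing.induct)
  case (ty_Var \<Gamma> x \<sigma>)
  then have "\<theta> x = \<theta>' x" by (auto intro: fmdom'I)
  then show ?case by simp
next
  case (ty_Lam x \<sigma> \<Gamma> M \<tau>)
  then have "subst (\<theta>(x := None)) M = subst (\<theta>'(x := None)) M" by (intro ty_Lam.IH) auto
  then show ?case by simp
next
  case (ty_Fix x \<sigma> \<tau> \<Gamma> M)
  then have "subst (\<theta>(x := None)) M = subst (\<theta>'(x := None)) M" by (intro ty_Fix.IH) auto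
  then show ?case by simp
next
  case (ty_Case \<Gamma> L \<sigma> M \<tau> h t N)
  then have "subst (\<theta>(h := None, t := None)) N = subst (\<theta>'(h := None, t := None)) N"
    by (intro ty_Case.IH(3)) auto
  then show ?case using ty_Case.IH(1,2)[OF ty_Case.prems] by simp
next
  case (ty_Pair \<Gamma> M \<sigma> N \<tau>)
  show ?case by (simp add: ty_Pair.IH[OF ty_Pair.prems])
next
  case (ty_Cons \<Gamma> M \<sigma> N)
  show ?case by (simp add: ty_Cons.IH[OF ty_Cons.prems])
next
  case (ty_Choice \<Gamma> M \<sigma> N)
  show ?case by (simp add: ty_Choice.IH[OF ty_Choice.prems])
next
  case (ty_If \<Gamma> L M \<sigma> N)
  show ?case by (simp add: ty_If.IH[OF ty_If.prems])
next
  case (ty_Op \<Gamma> M N f)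
  show ?case by (simp add: ty_Op.IH[OF ty_Op.prems])
next
  case (ty_Fst \<Gamma> M \<sigma> \<tau>)
  show ?case by (simp add: ty_Fst.IH[OF ty_Fst.prems])
next
  case (ty_Snd \<Gamma> M \<sigma> \<tau>)
  show ?case by (simp add: ty_Snd.IH[OF ty_Snd.prems])
next
  case (ty_App \<Gamma> M \<sigma> \<tau> N)
  show ?case by (simp add: ty_App.IH[OF ty_App.prems])
qed simp_all

lemma subst_empty [simp]: "subst Map.empty M = M"
proof -
  have [simp]: "(Map.empty(x := None)) = (Map.empty :: var \<rightharpoonup> 'a tm)" for x by auto
  show ?thesis by (induction M) (simp_all del: fun_upd_apply)
qed

lemma subst_closed: "fmempty \<turnstile> M \<Colon> \<sigma> \<Longrightarrow> subst \<theta> M = M"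
  using subst_cong[of fmempty M \<sigma> \<theta> Map.empty] by simp

lemma typing_subst: "\<Gamma> \<turnstile> M \<Colon> \<sigma> \<Longrightarrow> typed_subst \<Gamma> \<theta> \<Delta> \<Longrightarrow> \<Delta> \<turnstile> subst \<theta> M \<Colon> \<sigma>"
proof (induction arbitrary: \<Delta> \<theta> rule: typing.induct)
  case (ty_Var \<Gamma> x \<sigma>)
  then show ?case
    by (cases "\<theta> x") (auto simp: typed_subst_def closed_values_def intro: typing.ty_Var closed_typing)
next
  case (ty_Case \<Gamma> L \<sigma> M \<tau> h t N)
  note upd = typed_subst_upd[OF typed_subst_upd[OF ty_Case.prems]]
  show ?case unfolding subst.simps
    by (rule typing.ty_Case[OF ty_Case.IH(1,2)[OF ty_Case.prems] ty_Case.hyps(3) ty_Case.IH(3)[OF upd]])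
next
  case (ty_App \<Gamma> M \<sigma> \<tau> N)
  then show ?case using typing.ty_App by (metis subst.simps(15))
qed (auto intro: typing.intros typed_subst_upd simp del: fun_upd_apply)

text \<open>Everything that \<open>\<theta>\<close> inserts is closed, so \<open>\<eta>\<close>
  never acts inside it and composition is mere overriding of maps. Closedness is known only through
  typing, hence the typing hypotheses.\<close>

lemma subst_subst:
  "\<Gamma> \<turnstile> M \<Colon> \<sigma> \<Longrightarrow> typed_subst \<Gamma> \<theta> \<Delta> \<Longrightarrow> subst \<eta> (subst \<theta> M) = subst (\<eta> ++ \<theta>) M"
proof (induction arbitrary: \<Delta> \<theta> \<eta> rule: typing.induct)
  case (ty_Var \<Gamma> x \<sigma>)
  then show ?case
    by (cases "\<theta> x") (auto simp: typed_subst_def closed_values_def map_add_def intro: subst_closed)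
next
  case (ty_Lam x \<sigma> \<Gamma> M \<tau>)
  have "(\<eta> ++ \<theta>)(x := None) = \<eta>(x := None) ++ \<theta>(x := None)" by (auto simp: map_add_def fun_eq_iff split: option.splits)
  with ty_Lam.IH[OF typed_subst_upd[OF ty_Lam.prems]] show ?case by (simp del: fun_upd_apply)
next
  case (ty_Fix x \<sigma> \<tau> \<Gamma> M)
  have "(\<eta> ++ \<theta>)(x := None) = \<eta>(x := None) ++ \<theta>(x := None)" by (auto simp: map_add_def fun_eq_iff split: option.splits)
  with ty_Fix.IH[OF typed_subst_upd[OF ty_Fix.prems]] show ?case by (simp del: fun_upd_apply)
next
  case (ty_Case \<Gamma> L \<sigma> M \<tau> h t N)
  have "(\<eta> ++ \<theta>)(h := None, t := None) = \<eta>(h := None, t := None) ++ \<theta>(h := None, t := None)"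
    by (auto simp: map_add_def fun_eq_iff split: option.splits)
  with ty_Case.IH(1,2)[OF ty_Case.prems] ty_Case.IH(3)[OF typed_subst_upd[OF typed_subst_upd[OF ty_Case.prems]]]
  show ?case by (simp del: fun_upd_apply)
next
  case (ty_Pair \<Gamma> M \<sigma> N \<tau>)
  show ?case by (simp add: ty_Pair.IH[OF ty_Pair.prems])
next
  case (ty_Cons \<Gamma> M \<sigma> N)
  show ?case by (simp add: ty_Cons.IH[OF ty_Cons.prems])
next
  case (ty_Choice \<Gamma> M \<sigma> N)
  show ?case by (simp add: ty_Choice.IH[OF ty_Choice.prems])
next
  case (ty_If \<Gamma> L M \<sigma> N)
  show ?case by (simp add: ty_If.IH[OF ty_If.prems])
next
  case (ty_Op \<Gamma> M N f)
  show ?case by (simp add: ty_Op.IH[OF ty_Op.prems])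
next
  case (ty_Fst \<Gamma> M \<sigma> \<tau>)
  show ?case by (simp add: ty_Fst.IH[OF ty_Fst.prems])
next
  case (ty_Snd \<Gamma> M \<sigma> \<tau>)
  show ?case by (simp add: ty_Snd.IH[OF ty_Snd.prems])
next
  case (ty_App \<Gamma> M \<sigma> \<tau> N)
  show ?case by (simp add: ty_App.IH[OF ty_App.prems])
qed simp_all


subsection \<open>Canonical forms and type preservation\<close>

lemma closed_valuesD: "V \<in> closed_values \<sigma> \<Longrightarrow> is_value V" "V \<in> closed_values \<sigma> \<Longrightarrow> fmempty \<turnstile> V \<Colon> \<sigma>"
  by (auto simp: closed_values_def)

lemma closed_values_TInt: "V \<in> closed_values TInt \<Longrightarrow> (\<And>n. V = Num n \<Longrightarrow> P) \<Longrightarrow> P"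
  by (cases V) (auto simp: closed_values_def elim: typing_elims)

lemma closed_values_TBool: "V \<in> closed_values TBool \<Longrightarrow> (\<And>b. V = Bool b \<Longrightarrow> P) \<Longrightarrow> P"
  by (cases V) (auto simp: closed_values_def elim: typing_elims)

lemma closed_values_TProd:
  assumes "V \<in> closed_values (TProd \<sigma> \<tau>)"
  obtains M N where "V = PairT M N" "fmempty \<turnstile> M \<Colon> \<sigma>" "fmempty \<turnstile> N \<Colon> \<tau>"
  using assms by (cases V) (auto simp: closed_values_def elim: typing_elims)

lemma closed_values_TList:
  assumes "V \<in> closed_values (TList \<sigma>)"
  obtains "V = NilT" | M N where "V = ConsT M N" "fmempty \<turnstile> M \<Colon> \<sigma>" "fmempty \<turnstile> N \<Colon> TList \<sigma>"
  using assms by (cases V) (auto simp: closed_values_def elim: typing_elims)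

lemma closed_values_TFun:
  assumes "V \<in> closed_values (TFun \<sigma> \<tau>)"
  obtains x M where "V = Lam x M" "fmupd x \<sigma> fmempty \<turnstile> M \<Colon> \<tau>"
    | x M where "V = Fix x M" "fmupd x (TFun \<sigma> \<tau>) fmempty \<turnstile> M \<Colon> TFun \<sigma> \<tau>"
  using assms by (cases V) (auto simp: closed_values_def elim: typing_elims)

lemma typing_subst1:
  "fmupd x \<sigma> fmempty \<turnstile> M \<Colon> \<tau> \<Longrightarrow> V \<in> closed_values \<sigma> \<Longrightarrow> fmempty \<turnstile> subst [x \<mapsto> V] M \<Colon> \<tau>"
  by (erule typing_subst) (auto simp: typed_subst_def)

lemma typing_subst2:
  "fmupd t \<rho> (fmupd h \<sigma> fmempty) \<turnstile> M \<Colon> \<tau> \<Longrightarrow> V \<in> closed_values \<sigma> \<Longrightarrow> W \<in> closed_values \<rho> \<Longrightarrow>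
    fmempty \<turnstile> subst [h \<mapsto> V, t \<mapsto> W] M \<Colon> \<tau>"
  by (erule typing_subst) (auto simp: typed_subst_def)

lemma beta_typing:
  assumes "V \<in> closed_values (TFun \<sigma> \<tau>)" "W \<in> closed_values \<sigma>"
  shows "fmempty \<turnstile> beta V W \<Colon> \<tau>"
  using assms(1)
proof (cases rule: closed_values_TFun)
  case (1 x M)
  then show ?thesis using typing_subst1[OF 1(2) assms(2)] by simp
next
  case (2 x M)
  then show ?thesis
    using typing_subst1[OF 2(2) assms(1)] closed_valuesD(2)[OF assms(2)] by (auto intro: ty_App)
qed

lemma delta_typing:
  assumes "V \<in> closed_values TInt" "W \<in> closed_values TInt"
  shows "fmempty \<turnstile> delta f V W \<Colon> op_type (interp f)"
  using assms
  by (auto elim!: closed_values_TInt) (cases "interp f"; auto intro: typing.intros)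

text \<open>Type preservation for all outcomes of nonzero mass. It confines the distribution of a
  closed term to closed values of its type, the only ones that occur as states.\<close>

lemma ev_typing:
  assumes "ev n M V \<noteq> 0" "fmempty \<turnstile> M \<Colon> \<sigma>"
  shows "V \<in> closed_values \<sigma>"
  using assms
proof (induction n arbitrary: M V \<sigma>)
  case (Suc n)
  show ?case
  proof (cases "is_value M")
    case True
    with Suc.prems show ?thesis by (auto simp: dirac_def closed_values_def split: if_splits)
  next
    case False
    show ?thesis
    proof (cases M)
      case (Var x)
      then show ?thesis using Suc.prems by auto
    next
      case (Choice A B)
      then have "ev n A V \<noteq> 0 \<or> ev n B V \<noteq> 0" using Suc.prems(1) by auto
      then show ?thesis using Suc.prems Choice by (auto elim!: typing_elims dest: Suc.IH)
    next
      case (IfT L A B)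
      obtain U where U: "ev n L U \<noteq> 0" "ev n (branch U A B) V \<noteq> 0"
        using Suc.prems(1) unfolding IfT ev_Suc by (elim bind_nonzeroE) (rule that)
      have ty: "fmempty \<turnstile> L \<Colon> TBool" "fmempty \<turnstile> A \<Colon> \<sigma>" "fmempty \<turnstile> B \<Colon> \<sigma>"
        using Suc.prems(2) unfolding IfT by (auto elim: typing_elims)
      from Suc.IH[OF U(1) ty(1)] obtain b where "U = Bool b" by (rule closed_values_TBool)
      then show ?thesis using U(2) ty(2,3) Suc.IH[OF U(2)] by auto
    next
      case (OpT f A B)
      obtain U W where U: "ev n A U \<noteq> 0" "ev n B W \<noteq> 0" "ev n (delta f U W) V \<noteq> 0"
        using Suc.prems(1) unfolding OpT ev_Suc by (elim bind_nonzeroE) (rule that)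
      have ty: "fmempty \<turnstile> A \<Colon> TInt" "fmempty \<turnstile> B \<Colon> TInt" "\<sigma> = op_type (interp f)"
        using Suc.prems(2) unfolding OpT by (auto elim: typing_elims)
      show ?thesis
        using Suc.IH[OF U(3) delta_typing[OF Suc.IH[OF U(1) ty(1)] Suc.IH[OF U(2) ty(2)]]] ty(3) by simp
    next
      case (Fst A)
      obtain U where U: "ev n A U \<noteq> 0" "ev n (fst_of U) V \<noteq> 0"
        using Suc.prems(1) unfolding Fst ev_Suc by (elim bind_nonzeroE) (rule that)
      obtain \<tau> where ty: "fmempty \<turnstile> A \<Colon> TProd \<sigma> \<tau>"
        using Suc.prems(2) unfolding Fst by (auto elim: typing_elims)
      from Suc.IH[OF U(1) ty] show ?thesis using Suc.IH[OF U(2)] by (auto elim: closed_values_TProd)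
    next
      case (Snd A)
      obtain U where U: "ev n A U \<noteq> 0" "ev n (snd_of U) V \<noteq> 0"
        using Suc.prems(1) unfolding Snd ev_Suc by (elim bind_nonzeroE) (rule that)
      obtain \<tau> where ty: "fmempty \<turnstile> A \<Colon> TProd \<tau> \<sigma>"
        using Suc.prems(2) unfolding Snd by (auto elim: typing_elims)
      from Suc.IH[OF U(1) ty] show ?thesis using Suc.IH[OF U(2)] by (auto elim: closed_values_TProd)
    next
      case (CaseT L A h t B)
      from Suc.prems(2) obtain \<rho> where ty: "fmempty \<turnstile> L \<Colon> TList \<rho>" "fmempty \<turnstile> A \<Colon> \<sigma>"
        "fmupd t (TList \<rho>) (fmupd h \<rho> fmempty) \<turnstile> B \<Colon> \<sigma>"
        unfolding CaseT by (auto elim: typing_elims)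
      obtain U where U: "ev n L U \<noteq> 0" "unfold_list U (ev n) A (\<lambda>V W. subst [h \<mapsto> V, t \<mapsto> W] B) V \<noteq> 0"
        using Suc.prems(1) unfolding CaseT ev_Suc by (elim bind_nonzeroE) (rule that)
      from Suc.IH[OF U(1) ty(1)] show ?thesis
      proof (cases rule: closed_values_TList)
        case 1
        then show ?thesis using U(2) ty(2) Suc.IH by auto
      next
        case (2 X Y)
        obtain V' W where VW: "ev n X V' \<noteq> 0" "ev n Y W \<noteq> 0" "ev n (subst [h \<mapsto> V', t \<mapsto> W] B) V \<noteq> 0"
          using U(2) unfolding 2(1) unfold_list.simps by (elim bind_nonzeroE) (rule that)
        show ?thesis
          using Suc.IH[OF VW(3) typing_subst2[OF ty(3) Suc.IH[OF VW(1) 2(2)] Suc.IH[OF VW(2) 2(3)]]] .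
      qed
    next
      case (App A B)
      obtain U W where U: "ev n A U \<noteq> 0" "ev n B W \<noteq> 0" "ev n (beta U W) V \<noteq> 0"
        using Suc.prems(1) unfolding App ev_Suc by (elim bind_nonzeroE) (rule that)
      obtain \<rho> where ty: "fmempty \<turnstile> A \<Colon> TFun \<rho> \<sigma>" "fmempty \<turnstile> B \<Colon> \<rho>"
        using Suc.prems(2) unfolding App by (auto elim: typing_elims)
      show ?thesis
        using Suc.IH[OF U(3) beta_typing[OF Suc.IH[OF U(1) ty(1)] Suc.IH[OF U(2) ty(2)]]] .
    qed (use False in auto)
  qed
qed simp

lemma sem_typing: "sem M V \<noteq> 0 \<Longrightarrow> fmempty \<turnstile> M \<Colon> \<sigma> \<Longrightarrow> V \<in> closed_values \<sigma>"
  using ev_typing[of _ M V \<sigma>] by (auto simp: sem_eq_SUP_ev SUP_eq_iff)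


section \<open>Simulations and bisimulations\<close>

lemma prob_set_nn_integral: "prob_set s l X = (\<integral>\<^sup>+x. prob s l x \<partial>count_space X)"
  by (simp add: prob_set_def infsum_eq_nn_integral_count_space)

lemma prob_set_mono: "X \<subseteq> Y \<Longrightarrow> prob_set s l X \<le> prob_set s l Y"
  by (simp add: prob_set_nn_integral nn_integral_count_space_mono_set)

lemma dtrans_LEval: "\<not> dtrans s LEval t"
  by (auto elim: dtrans.cases)

lemma dtrans_deterministic: "dtrans s l x \<Longrightarrow> dtrans s l y \<Longrightarrow> x = y"
  by (auto elim!: dtrans.cases)

lemma prob_dtrans: "dtrans s l x \<Longrightarrow> prob s l x = 1"
  using dtrans_LEval by (auto simp: prob_def split: state.splits label.splits)

lemma prob_VState: "prob (VState V \<sigma>) l x = (if dtrans (VState V \<sigma>) l x then 1 else 0)"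
  by (simp add: prob_def)

lemma prob_TState: "l \<noteq> LEval \<Longrightarrow> prob (TState M \<sigma>) l x = (if dtrans (TState M \<sigma>) l x then 1 else 0)"
  by (auto simp: prob_def split: state.splits label.splits)

lemma prob_TState_LEval:
  "prob (TState M \<sigma>) LEval x = (case x of VState V \<tau> \<Rightarrow> if \<tau> = \<sigma> then sem M V else 0 | _ \<Rightarrow> 0)"
  by (auto simp: prob_def dtrans_LEval split: state.splits)

text \<open>Transitions other than \<open>LEval\<close> are deterministic, so the distribution on
  the left is a point mass or zero, and comparing masses amounts to matching one transition.\<close>

lemma prob_set_le_dtrans:
  assumes "\<And>x. prob s l x = (if dtrans s l x then 1 else 0)"
    and "\<And>x. x \<in> X \<Longrightarrow> dtrans s l x \<Longrightarrow> \<exists>y\<in>Y. dtrans t l y"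
  shows "prob_set s l X \<le> prob_set t l Y"
proof (cases "\<exists>x\<in>X. dtrans s l x")
  case True
  then obtain x y where x: "x \<in> X" "dtrans s l x" and y: "y \<in> Y" "dtrans t l y"
    using assms(2) by blast
  have "dtrans s l z \<longleftrightarrow> z = x" for z using dtrans_deterministic[OF x(2), of z] x(2) by auto
  then have "prob s l = dirac x" by (simp add: dirac_def fun_eq_iff assms(1))
  then have "prob_set s l X = 1" using x(1) by (simp add: prob_set_nn_integral nn_integral_dirac)
  also have "1 = (\<integral>\<^sup>+z. dirac y z \<partial>count_space Y)" using y(1) by (simp add: nn_integral_dirac)
  also have "\<dots> \<le> prob_set t l Y"
    unfolding prob_set_nn_integral
    by (rule nn_integral_mono) (simp add: dirac_def prob_dtrans[OF y(2)])
  finally show ?thesis .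
next
  case False
  then have "prob_set s l X = (\<integral>\<^sup>+x. 0 \<partial>count_space X)"
    unfolding prob_set_nn_integral by (intro nn_integral_cong) (auto simp: assms(1))
  then show ?thesis by simp
qed

lemma prob_set_eval:
  "prob_set (TState M \<sigma>) LEval X = (\<integral>\<^sup>+V. sem M V \<partial>count_space {V. VState V \<sigma> \<in> X})"
proof -
  let ?A = "{V. VState V \<sigma> \<in> X}"
  have "(\<integral>\<^sup>+V. sem M V \<partial>count_space ?A) =
      (\<integral>\<^sup>+V. prob (TState M \<sigma>) LEval (VState V \<sigma>) \<partial>count_space ?A)"
    by (simp add: prob_TState_LEval)
  also have "\<dots> = (\<integral>\<^sup>+x. prob (TState M \<sigma>) LEval x \<partial>count_space ((\<lambda>V. VState V \<sigma>) ` ?A))"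
    by (rule nn_integral_bij_count_space) (auto simp: bij_betw_def inj_on_def)
  also have "\<dots> = (\<integral>\<^sup>+x. prob (TState M \<sigma>) LEval x \<partial>count_space X)"
    by (rule nn_integral_count_space_eq) (auto simp: prob_TState_LEval split: state.splits)
  finally show ?thesis by (simp add: prob_set_nn_integral)
qed

text \<open>A simulation without transitivity. Neither a union of simulations nor the Howe closure
  is visibly transitive, but the clause itself survives transitive closure.\<close>

definition presim :: "'op::operators state rel \<Rightarrow> bool" where
  "presim R \<longleftrightarrow> R \<subseteq> states \<times> states \<and> refl_on states R \<and>
     (\<forall>(s, t) \<in> R. \<forall>l. \<forall>X \<subseteq> states. prob_set s l X \<le> prob_set t l (R `` X))"

lemma simulation_iff_presim: "simulation R \<longleftrightarrow> presim R \<and> trans R"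
  by (auto simp: simulation_def presim_def preorder_on_def)

lemma presimD:
  "presim R \<Longrightarrow> (s, t) \<in> R \<Longrightarrow> X \<subseteq> states \<Longrightarrow> prob_set s l X \<le> prob_set t l (R `` X)"
  by (auto simp: presim_def)

lemma presim_trancl:
  fixes R :: "'op::operators state rel"
  assumes R: "presim R"
  shows "simulation (R\<^sup>+)"
  unfolding simulation_def
proof (intro conjI ballI allI impI, safe)
  have R_sub: "R\<^sup>+ \<subseteq> states \<times> states"
    using R by (intro trancl_subset_Sigma) (auto simp: presim_def)
  show "preorder_on states (R\<^sup>+)"
    using R R_sub by (auto simp: preorder_on_def presim_def refl_on_def)
  fix s t l and X :: "'op state set" assume st: "(s, t) \<in> R\<^sup>+" and X: "X \<subseteq> states"
  from st show "prob_set s l X \<le> prob_set t l (R\<^sup>+ `` X)"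
  proof induction
    case (base t)
    have "prob_set s l X \<le> prob_set t l (R `` X)" by (rule presimD[OF R base X])
    also have "\<dots> \<le> prob_set t l (R\<^sup>+ `` X)" by (rule prob_set_mono) auto
    finally show ?case .
  next
    case (step t u)
    note step.IH
    \<comment> \<open>The image of \<open>X\<close> under the closure is again a set of states, so
      the clause for one more step applies to it, and that step does not lead out of it.\<close>
    also have "prob_set t l (R\<^sup>+ `` X) \<le> prob_set u l (R `` (R\<^sup>+ `` X))"
      using R_sub by (intro presimD[OF R step.hyps(2)]) auto
    also have "\<dots> \<le> prob_set u l (R\<^sup>+ `` X)"
      by (rule prob_set_mono) (auto intro: trancl_into_trancl)
    finally show ?case .
  qed
qed

lemma presim_Union:
  fixes \<R> :: "'op::operators state rel set"
  assumes "\<And>R. R \<in> \<R> \<Longrightarrow> presim R" "\<R> \<noteq> {}"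
  shows "presim (\<Union>\<R>)"
  unfolding presim_def
proof (intro conjI ballI allI impI, safe)
  show "s \<in> states" "t \<in> states" if "(s, t) \<in> R" "R \<in> \<R>" for s t R
    using assms(1)[OF that(2)] that(1) by (auto simp: presim_def)
  show "refl_on states (\<Union>\<R>)" using assms by (fastforce simp: presim_def refl_on_def)
  fix s t R l and X :: "'op state set" assume *: "(s, t) \<in> R" "R \<in> \<R>" "X \<subseteq> states"
  then have "prob_set s l X \<le> prob_set t l (R `` X)" by (intro presimD assms(1))
  also have "\<dots> \<le> prob_set t l (\<Union>\<R> `` X)" by (rule prob_set_mono) (use * in auto)
  finally show "prob_set s l X \<le> prob_set t l (\<Union>\<R> `` X)" .
qed

lemma presim_Id: "presim (Id_on states)"
  unfolding presim_def
proof (intro conjI ballI allI impI, safe)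
  fix s l X assume X: "X \<subseteq> states"
  then have "Id_on states `` X = X" by auto
  then show "prob_set s l X \<le> prob_set s l (Id_on states `` X)" by simp
qed (auto simp: refl_on_def)

lemma simulation_Id: "simulation (Id_on states)"
  by (simp add: simulation_iff_presim presim_Id trans_Id_on)

text \<open>A union of preorders need not be transitive. Its transitive closure, however, is a
  simulation and therefore already contained in the union.\<close>

lemma simulation_similarity: "simulation (similarity :: 'a::operators state rel)"
proof -
  have "{R. simulation R} \<noteq> ({} :: 'a state rel set)" using simulation_Id by blast
  then have "presim (similarity :: 'a state rel)"
    unfolding similarity_def by (intro presim_Union) (auto simp: simulation_iff_presim)
  then have *: "simulation ((similarity :: 'a state rel)\<^sup>+)" by (rule presim_trancl)
  then have "similarity\<^sup>+ \<subseteq> (similarity :: 'a state rel)" unfolding similarity_def by blast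
  then have "similarity\<^sup>+ = (similarity :: 'a state rel)" by (intro subset_antisym) auto
  with * show ?thesis by simp
qed

section \<open>Bisimulations as symmetric simulations\<close>

lemma nn_integral_Union_disjoint:
  fixes f :: "'a \<Rightarrow> ennreal"
  assumes "\<And>A B. A \<in> C \<Longrightarrow> B \<in> C \<Longrightarrow> A \<inter> B \<noteq> {} \<Longrightarrow> A = B"
  shows "(\<integral>\<^sup>+x. f x \<partial>count_space (\<Union>C)) = (\<integral>\<^sup>+A. (\<integral>\<^sup>+x. f x \<partial>count_space A) \<partial>count_space C)"
proof -
  have ind: "(\<integral>\<^sup>+A. f x * indicator A x * indicator C A \<partial>count_space UNIV) = f x * indicator (\<Union>C) x" for x
  proof (cases "x \<in> \<Union>C")
    case True
    then obtain B where B: "B \<in> C" "x \<in> B" by auto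
    have "(\<integral>\<^sup>+A. f x * indicator A x * indicator C A \<partial>count_space UNIV) =
        (\<Sum>A\<in>{B}. f x * indicator A x * indicator C A)"
      using B assms[OF B(1)] by (intro nn_integral_count_space') (auto split: split_indicator)
    then show ?thesis using B True by simp
  next
    case False
    then have "(\<lambda>A. f x * indicator A x * indicator C A) = (\<lambda>_. 0)"
      by (auto simp: fun_eq_iff split: split_indicator)
    with False show ?thesis by simp
  qed
  have "(\<integral>\<^sup>+x. f x \<partial>count_space (\<Union>C)) =
      (\<integral>\<^sup>+x. \<integral>\<^sup>+A. (\<lambda>(x, A). f x * indicator A x * indicator C A) (x, A) \<partial>count_space UNIV \<partial>count_space UNIV)"
    by (simp add: ind nn_integral_count_space_indicator)
  also have "\<dots> =
      (\<integral>\<^sup>+A. \<integral>\<^sup>+x. (\<lambda>(x, A). f x * indicator A x * indicator C A) (x, A) \<partial>count_space UNIV \<partial>count_space UNIV)"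
    unfolding nn_integral_fst_count_space nn_integral_snd_count_space ..
  also have "\<dots> = (\<integral>\<^sup>+A. (\<integral>\<^sup>+x. f x \<partial>count_space A) \<partial>count_space C)"
    by (simp add: nn_integral_count_space_indicator[of C] nn_integral_count_space_indicator[of _ f]
        nn_integral_multc[symmetric])
  finally show ?thesis .
qed

text \<open>Forwards, the \<open>R\<close>-image of \<open>X\<close> is a disjoint union of classes
  on which the masses agree. Backwards, a class is closed under \<open>R\<close>, so the simulation
  clause compares masses on one and the same class, and symmetry gives the other inequality.\<close>

lemma bisimulation_iff: "bisimulation R \<longleftrightarrow> simulation R \<and> sym R"
proof safe
  assume R: "bisimulation R"
  then have eq: "equiv states R"
    and prob: "\<And>s t l E. (s, t) \<in> R \<Longrightarrow> E \<in> states // R \<Longrightarrow> prob_set s l E = prob_set t l E"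
    by (auto simp: bisimulation_def)
  show "sym R" using eq by (auto simp: equiv_def)
  have "prob_set s l X \<le> prob_set t l (R `` X)" if st: "(s, t) \<in> R" and X: "X \<subseteq> states" for s t l X
  proof -
    define C where "C = (\<lambda>x. R `` {x}) ` X"
    have C: "C \<subseteq> states // R" using X by (auto simp: C_def quotient_def)
    have RX: "R `` X = \<Union>C" by (auto simp: C_def)
    have disj: "A = B" if "A \<in> C" "B \<in> C" "A \<inter> B \<noteq> {}" for A B
      using that C quotient_disj[OF eq] by blast
    have "prob_set s l X \<le> prob_set s l (R `` X)"
      using eq X by (intro prob_set_mono) (auto simp: equiv_def refl_on_def)
    also have "\<dots> = (\<integral>\<^sup>+A. prob_set s l A \<partial>count_space C)"
      unfolding RX prob_set_nn_integral by (rule nn_integral_Union_disjoint[OF disj])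
    also have "\<dots> = (\<integral>\<^sup>+A. prob_set t l A \<partial>count_space C)"
      using C by (intro nn_integral_cong prob[OF st]) auto
    also have "\<dots> = prob_set t l (R `` X)"
      unfolding RX prob_set_nn_integral by (rule nn_integral_Union_disjoint[OF disj, symmetric])
    finally show ?thesis .
  qed
  then show "simulation R"
    using eq by (auto simp: simulation_def preorder_on_def equiv_def)
next
  assume R: "simulation R" "sym R"
  then have eq: "equiv states R" by (auto simp: equiv_def simulation_def preorder_on_def)
  have le: "prob_set s l E \<le> prob_set t l E" if st: "(s, t) \<in> R" and E: "E \<in> states // R" for s t l E
  proof -
    have "E \<subseteq> states" using E eq by (auto simp: quotient_def equiv_def)
    moreover obtain x where x: "E = R `` {x}" using E by (auto elim: quotientE)
    have "R `` E \<subseteq> E" unfolding x using R(1) by (auto simp: simulation_iff_presim dest: transD)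
    ultimately show ?thesis
      using presimD[of R s t E l] prob_set_mono[of "R `` E" E t l] R(1) st
      by (auto simp: simulation_iff_presim)
  qed
  have "prob_set s l E = prob_set t l E" if "(s, t) \<in> R" "E \<in> states // R" for s t l E
    using le[OF that] le[OF symD[OF R(2) that(1)] that(2)] by (rule antisym)
  then show "bisimulation R" using eq by (auto simp: bisimulation_def)
qed

lemma bisimulation_bisimilarity: "bisimulation (bisimilarity :: 'a::operators state rel)"
proof -
  have "bisimulation (Id_on states :: 'a state rel)" by (simp add: bisimulation_iff simulation_Id sym_Id_on)
  then have "{R. bisimulation R} \<noteq> ({} :: 'a state rel set)" by blast
  then have "presim (bisimilarity :: 'a state rel)"
    unfolding bisimilarity_def
    by (intro presim_Union) (auto simp: bisimulation_iff simulation_iff_presim)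
  moreover have "sym (bisimilarity :: 'a state rel)"
    unfolding bisimilarity_def by (rule symI) (auto simp: bisimulation_iff dest: symD)
  ultimately have *: "bisimulation ((bisimilarity :: 'a state rel)\<^sup>+)"
    by (simp add: bisimulation_iff presim_trancl sym_trancl)
  then have "bisimilarity\<^sup>+ \<subseteq> (bisimilarity :: 'a state rel)" unfolding bisimilarity_def by blast
  then have "bisimilarity\<^sup>+ = (bisimilarity :: 'a state rel)" by (intro subset_antisym) auto
  with * show ?thesis by simp
qed

lemma bisimilarity_subset_similarity: "bisimilarity \<subseteq> similarity"
  by (auto simp: bisimilarity_def similarity_def bisimulation_iff)


subsection \<open>Transitions of related states\<close>

lemma states_simps [simp]:
  "TState M \<sigma> \<in> states \<longleftrightarrow> fmempty \<turnstile> M \<Colon> \<sigma>"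
  "VState V \<sigma> \<in> states \<longleftrightarrow> V \<in> closed_values \<sigma>"
  by (auto simp: states_def)

text \<open>The clause is applied to the singleton of \<open>x\<close>: mass one on the left forces
  nonzero mass on the right, and for a label other than \<open>LEval\<close> this means an actual
  transition.\<close>

lemma presim_dtrans:
  assumes "presim R" "(s, t) \<in> R" "dtrans s l x" "x \<in> states"
  obtains y where "dtrans t l y" "(x, y) \<in> R"
proof -
  have l: "l \<noteq> LEval" using assms(3) dtrans_LEval by auto
  have "prob_set s l {x} = 1"
    by (simp add: prob_set_nn_integral nn_integral_count_space_finite prob_dtrans[OF assms(3)])
  then have "1 \<le> prob_set t l (R `` {x})"
    using presimD[OF assms(1,2), of "{x}" l] assms(4) by simp
  moreover have "prob_set t l (R `` {x}) = 0" if "\<And>y. y \<in> R `` {x} \<Longrightarrow> \<not> dtrans t l y"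
  proof -
    have "prob t l y = 0" if "\<not> dtrans t l y" for y
      using that l by (cases t) (simp_all add: prob_TState prob_VState)
    with that have "prob_set t l (R `` {x}) = (\<integral>\<^sup>+y. 0 \<partial>count_space (R `` {x}))"
      unfolding prob_set_nn_integral by (intro nn_integral_cong) auto
    then show ?thesis by simp
  qed
  ultimately show thesis using that by force
qed

definition value_rel :: "'op::operators state rel \<Rightarrow> ty \<Rightarrow> 'op tm rel" where
  "value_rel R \<sigma> = {(V, W). V \<in> closed_values \<sigma> \<and> W \<in> closed_values \<sigma> \<and> (VState V \<sigma>, VState W \<sigma>) \<in> R}"

lemma presim_VState:
  "presim R \<Longrightarrow> (VState V \<sigma>, VState W \<tau>) \<in> R \<Longrightarrow> V \<in> closed_values \<sigma> \<and> W \<in> closed_values \<tau>"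
  unfolding presim_def by (metis SigmaE2 states_simps(2) subsetD)

lemma presim_sem:
  fixes M N :: "'op::operators tm"
  assumes "presim R" "(TState M \<sigma>, TState N \<sigma>) \<in> R"
  shows "lift (value_rel R \<sigma>) (sem M) (sem N)"
  unfolding lift_def
proof
  fix X :: "'op tm set"
  let ?X = "(\<lambda>V. VState V \<sigma>) ` (X \<inter> closed_values \<sigma>)"
  have M: "fmempty \<turnstile> M \<Colon> \<sigma>" using assms by (auto simp: presim_def)
  \<comment> \<open>The simulation clause speaks only of sets of states. Terms in \<open>X\<close>
    that are not closed values of type \<open>\<sigma>\<close> have mass zero and may be
    dropped.\<close>
  have "(\<integral>\<^sup>+V. sem M V \<partial>count_space X) = (\<integral>\<^sup>+V. sem M V \<partial>count_space (X \<inter> closed_values \<sigma>))"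
    using sem_typing[OF _ M] by (intro nn_integral_count_space_eq) auto
  also have "X \<inter> closed_values \<sigma> = {V. VState V \<sigma> \<in> ?X}" by auto
  also have "(\<integral>\<^sup>+V. sem M V \<partial>count_space \<dots>) = prob_set (TState M \<sigma>) LEval ?X"
    by (rule prob_set_eval[symmetric])
  also have "\<dots> \<le> prob_set (TState N \<sigma>) LEval (R `` ?X)"
    by (rule presimD[OF assms]) auto
  also have "\<dots> \<le> (\<integral>\<^sup>+V. sem N V \<partial>count_space (value_rel R \<sigma> `` X))"
    unfolding prob_set_eval using presim_VState[OF assms(1)]
    by (intro nn_integral_count_space_mono_set) (auto simp: value_rel_def)
  finally show "(\<integral>\<^sup>+V. sem M V \<partial>count_space X) \<le> \<dots>" .
qed

text \<open>The value \<open>V\<close> evaluates to itself with mass one, so the sole outcome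
  \<open>W\<close> of the other side must lie in the image of the singleton of
  \<open>V\<close>.\<close>

lemma presim_values:
  assumes "presim R" "(TState V \<sigma>, TState W \<sigma>) \<in> R" "is_value V" "is_value W"
  shows "(VState V \<sigma>, VState W \<sigma>) \<in> R"
  using liftD[OF presim_sem[OF assms(1,2)], of "{V}"] assms(3,4)
  by (auto simp: sem_value nn_integral_dirac value_rel_def split: split_indicator_asm)

lemma prob_set_eval_le:
  assumes "lift Q (sem M) (sem N)" "\<And>V W. (V, W) \<in> Q \<Longrightarrow> (VState V \<sigma>, VState W \<sigma>) \<in> R"
  shows "prob_set (TState M \<sigma>) LEval X \<le> prob_set (TState N \<sigma>) LEval (R `` X)"
  unfolding prob_set_eval
  by (rule order_trans[OF liftD[OF assms(1)] nn_integral_count_space_mono_set]) (auto dest: assms(2))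

lemma prob_set_TState_le:
  assumes "lift Q (sem M) (sem N)" "\<And>V W. (V, W) \<in> Q \<Longrightarrow> (VState V \<sigma>, VState W \<sigma>) \<in> R"
    "(TState M \<sigma>, TState N \<sigma>) \<in> R"
  shows "prob_set (TState M \<sigma>) l X \<le> prob_set (TState N \<sigma>) l (R `` X)"
proof (cases "l = LEval")
  case True
  then show ?thesis using prob_set_eval_le[OF assms(1,2)] by simp
next
  case False
  show ?thesis
  proof (rule prob_set_le_dtrans)
    fix x assume "x \<in> X" "dtrans (TState M \<sigma>) l x"
    then have "l = LType \<sigma>" "TState M \<sigma> \<in> X" by (auto elim: dtrans.cases)
    then show "\<exists>y\<in>R `` X. dtrans (TState N \<sigma>) l y"
      using assms(3) dtrans.intros(1)[of "TState N \<sigma>"] by auto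
  qed (simp add: prob_TState False)
qed

text \<open>The only transition of a value regarded as a term, apart from its type, is to itself as a value.\<close>

lemma presim_value_closure:
  fixes R :: "'op::operators state rel"
  assumes "presim R"
  defines "R' \<equiv> R \<union> {(TState V \<sigma>, TState W \<sigma>) | V W \<sigma>. (VState V \<sigma>, VState W \<sigma>) \<in> R}"
  shows "presim R'"
  unfolding presim_def
proof (intro conjI ballI allI impI, safe)
  have R_sub: "R \<subseteq> states \<times> states" using assms(1) by (simp add: presim_def)
  have "(TState V \<sigma>, TState W \<sigma>) \<in> states \<times> states" if "(VState V \<sigma>, VState W \<sigma>) \<in> R" for V W \<sigma>
    using presim_VState[OF assms(1) that] by (auto dest: closed_valuesD)
  then have R'_sub: "R' \<subseteq> states \<times> states" using R_sub by (auto simp: R'_def)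
  then show "s \<in> states" "t \<in> states" if "(s, t) \<in> R'" for s t using that by auto
  show "refl_on states R'" using assms by (auto simp: R'_def presim_def refl_on_def)
  fix s t l and X :: "'op state set" assume st: "(s, t) \<in> R'" and X: "X \<subseteq> states"
  from st consider "(s, t) \<in> R"
    | V W \<sigma> where "s = TState V \<sigma>" "t = TState W \<sigma>" "(VState V \<sigma>, VState W \<sigma>) \<in> R"
    by (auto simp: R'_def)
  then show "prob_set s l X \<le> prob_set t l (R' `` X)"
  proof cases
    case 1
    have "prob_set s l X \<le> prob_set t l (R `` X)" by (rule presimD[OF assms(1) 1 X])
    also have "\<dots> \<le> prob_set t l (R' `` X)" by (rule prob_set_mono) (auto simp: R'_def)
    finally show ?thesis .
  next
    case 2
    have "is_value V" "is_value W" using presim_VState[OF assms(1) 2(3)] by (auto dest: closed_valuesD)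
    then have "lift {(V, W)} (sem V) (sem W)" by (simp add: sem_value lift_dirac)
    then show ?thesis
      unfolding 2(1,2) by (rule prob_set_TState_le) (use 2(3) in \<open>auto simp: R'_def\<close>)
  qed
qed


section \<open>Compatible refinement\<close>

text \<open>One layer of constructors over \<open>R\<close>. Compatibility says that
  \<open>R\<close> contains its refinement, which turns a long conjunction into a single rule for
  case analysis.\<close>

inductive refine :: "'op::operators typed_rel \<Rightarrow> 'op typed_rel" for R where
  rf_Var: "fmlookup \<Gamma> x = Some \<sigma> \<Longrightarrow> refine R \<Gamma> \<sigma> (Var x) (Var x)"
| rf_Num: "refine R \<Gamma> TInt (Num n) (Num n)"
| rf_Bool: "refine R \<Gamma> TBool (Bool b) (Bool b)"
| rf_Nil: "refine R \<Gamma> (TList \<sigma>) NilT NilT"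
| rf_Pair: "R \<Gamma> \<sigma> M M' \<Longrightarrow> R \<Gamma> \<tau> N N' \<Longrightarrow> refine R \<Gamma> (TProd \<sigma> \<tau>) (PairT M N) (PairT M' N')"
| rf_Cons: "R \<Gamma> \<sigma> M M' \<Longrightarrow> R \<Gamma> (TList \<sigma>) N N' \<Longrightarrow> refine R \<Gamma> (TList \<sigma>) (ConsT M N) (ConsT M' N')"
| rf_Lam: "R (fmupd x \<sigma> \<Gamma>) \<tau> M M' \<Longrightarrow> refine R \<Gamma> (TFun \<sigma> \<tau>) (Lam x M) (Lam x M')"
| rf_Fix: "R (fmupd x (TFun \<sigma> \<tau>) \<Gamma>) (TFun \<sigma> \<tau>) M M' \<Longrightarrow> refine R \<Gamma> (TFun \<sigma> \<tau>) (Fix x M) (Fix x M')"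
| rf_Choice: "R \<Gamma> \<sigma> M M' \<Longrightarrow> R \<Gamma> \<sigma> N N' \<Longrightarrow> refine R \<Gamma> \<sigma> (Choice M N) (Choice M' N')"
| rf_If: "R \<Gamma> TBool L L' \<Longrightarrow> R \<Gamma> \<sigma> M M' \<Longrightarrow> R \<Gamma> \<sigma> N N' \<Longrightarrow> refine R \<Gamma> \<sigma> (IfT L M N) (IfT L' M' N')"
| rf_Op: "R \<Gamma> TInt M M' \<Longrightarrow> R \<Gamma> TInt N N' \<Longrightarrow>
    refine R \<Gamma> (op_type (interp f)) (OpT f M N) (OpT f M' N')"
| rf_Fst: "R \<Gamma> (TProd \<sigma> \<tau>) M M' \<Longrightarrow> refine R \<Gamma> \<sigma> (Fst M) (Fst M')"
| rf_Snd: "R \<Gamma> (TProd \<sigma> \<tau>) M M' \<Longrightarrow> refine R \<Gamma> \<tau> (Snd M) (Snd M')"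
| rf_Case: "R \<Gamma> (TList \<sigma>) L L' \<Longrightarrow> R \<Gamma> \<tau> M M' \<Longrightarrow> h \<noteq> t \<Longrightarrow>
    R (fmupd t (TList \<sigma>) (fmupd h \<sigma> \<Gamma>)) \<tau> N N' \<Longrightarrow>
    refine R \<Gamma> \<tau> (CaseT L M h t N) (CaseT L' M' h t N')"
| rf_App: "R \<Gamma> (TFun \<sigma> \<tau>) M M' \<Longrightarrow> R \<Gamma> \<sigma> N N' \<Longrightarrow> refine R \<Gamma> \<tau> (App M N) (App M' N')"

text \<open>Monotonicity is what allows the Howe closure to be defined inductively through its own
  refinement.\<close>

lemma refine_mono [mono]:
  "(\<And>\<Gamma> \<sigma> M N. R \<Gamma> \<sigma> M N \<longrightarrow> S \<Gamma> \<sigma> M N) \<Longrightarrow> refine R \<Gamma> \<sigma> M N \<longrightarrow> refine S \<Gamma> \<sigma> M N"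
  by (rule impI, erule refine.cases; hypsubst; blast intro: refine.intros)

lemma refine_imp:
  "refine R \<Gamma> \<sigma> M N \<Longrightarrow> (\<And>\<Gamma> \<sigma> M N. R \<Gamma> \<sigma> M N \<Longrightarrow> S \<Gamma> \<sigma> M N) \<Longrightarrow> refine S \<Gamma> \<sigma> M N"
  using refine_mono[of R S] by blast

lemma refine_typing:
  assumes "refine R \<Gamma> \<sigma> M N" "\<And>\<Gamma> \<sigma> M N. R \<Gamma> \<sigma> M N \<Longrightarrow> \<Gamma> \<turnstile> M \<Colon> \<sigma> \<and> \<Gamma> \<turnstile> N \<Colon> \<sigma>"
  shows "\<Gamma> \<turnstile> M \<Colon> \<sigma> \<and> \<Gamma> \<turnstile> N \<Colon> \<sigma>"
  using assms(1)
proof cases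
  case (rf_App \<sigma>)
  then show ?thesis by (metis assms(2) ty_App)
next
  case (rf_Case \<sigma>)
  then show ?thesis by (metis assms(2) ty_Case)
qed (auto intro: typing.intros dest: assms(2))

lemma refine_converse:
  "refine R \<Gamma> \<sigma> M N \<Longrightarrow> refine (\<lambda>\<Gamma> \<sigma> M N. R \<Gamma> \<sigma> N M) \<Gamma> \<sigma> N M"
  by (erule refine.cases) (auto intro: refine.intros)

lemma refine_is_value: "refine R \<Gamma> \<sigma> M N \<Longrightarrow> is_value M \<longleftrightarrow> is_value N"
  by (erule refine.cases) auto

lemma compatible_iff_refine:
  "compatible R \<longleftrightarrow> (\<forall>\<Gamma> \<sigma> M N. refine R \<Gamma> \<sigma> M N \<longrightarrow> R \<Gamma> \<sigma> M N)" (is "_ \<longleftrightarrow> ?r")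
proof
  assume c: "compatible R"
  show ?r
  proof (intro allI impI)
    fix \<Gamma> \<sigma> M N assume "refine R \<Gamma> \<sigma> M N"
    then show "R \<Gamma> \<sigma> M N"
      by cases (use c in \<open>simp_all add: compatible_def\<close>, (blast+)?)
  qed
next
  assume ?r
  then show "compatible R" unfolding compatible_def by (intro conjI allI impI) (blast intro: refine.intros)+
qed

lemma tranclp_map:
  assumes "R\<^sup>+\<^sup>+ x y" "\<And>x y. R x y \<Longrightarrow> S (f x) (f y)"
  shows "S\<^sup>+\<^sup>+ (f x) (f y)"
  using assms(1) by induction (auto intro: assms(2) tranclp.trancl_into_trancl)

text \<open>The two chains may differ in length, so the arguments move one after the other;
  reflexivity at \<open>y\<close> and then at \<open>x'\<close> keeps the resting argument related
  to itself.\<close>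

lemma tranclp_map2:
  assumes "R\<^sup>+\<^sup>+ x x'" "Q\<^sup>+\<^sup>+ y y'" and refl: "R x' x'" "Q y y"
    and S: "\<And>x x' y y'. R x x' \<Longrightarrow> Q y y' \<Longrightarrow> S (f x y) (f x' y')"
  shows "S\<^sup>+\<^sup>+ (f x y) (f x' y')"
proof -
  have "S\<^sup>+\<^sup>+ (f x y) (f x' y)"
    by (rule tranclp_map[OF assms(1), of S "\<lambda>x. f x y"]) (auto intro: S refl)
  also have "S\<^sup>+\<^sup>+ (f x' y) (f x' y')"
    by (rule tranclp_map[OF assms(2), of S "f x'"]) (auto intro: S refl)
  finally show ?thesis .
qed

lemma tranclp_map3:
  assumes "R\<^sup>+\<^sup>+ x x'" "Q\<^sup>+\<^sup>+ y y'" "T\<^sup>+\<^sup>+ z z'" and refl: "R x' x'" "Q y y" "Q y' y'" "T z z"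
    and S: "\<And>x x' y y' z z'. R x x' \<Longrightarrow> Q y y' \<Longrightarrow> T z z' \<Longrightarrow> S (f x y z) (f x' y' z')"
  shows "S\<^sup>+\<^sup>+ (f x y z) (f x' y' z')"
proof -
  have "S\<^sup>+\<^sup>+ (f x y z) (f x' y' z)"
    by (rule tranclp_map2[OF assms(1,2), of S "\<lambda>x y. f x y z"]) (auto intro: S refl)
  also have "S\<^sup>+\<^sup>+ (f x' y' z) (f x' y' z')"
    by (rule tranclp_map[OF assms(3), of S "f x' y'"]) (auto intro: S refl)
  finally show ?thesis .
qed

text \<open>Reflexivity is asked only of terms that occur in related pairs, because a typed relation
  is reflexive on typable terms at best.\<close>

lemma refine_tranclp:
  assumes compat: "\<And>\<Gamma> \<sigma> M N. refine R \<Gamma> \<sigma> M N \<Longrightarrow> R \<Gamma> \<sigma> M N"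
    and refl: "\<And>\<Gamma> \<sigma> M N. R \<Gamma> \<sigma> M N \<Longrightarrow> R \<Gamma> \<sigma> M M \<and> R \<Gamma> \<sigma> N N"
    and "refine (\<lambda>\<Gamma> \<sigma>. (R \<Gamma> \<sigma>)\<^sup>+\<^sup>+) \<Gamma> \<sigma> M N"
  shows "(R \<Gamma> \<sigma>)\<^sup>+\<^sup>+ M N"
proof -
  have left: "R \<Gamma> \<sigma> M M" if "(R \<Gamma> \<sigma>)\<^sup>+\<^sup>+ M N" for \<Gamma> \<sigma> M N
    using that by induction (use refl in blast)+
  have right: "R \<Gamma> \<sigma> N N" if "(R \<Gamma> \<sigma>)\<^sup>+\<^sup>+ M N" for \<Gamma> \<sigma> M N
    using that by induction (use refl in blast)+
  from assms(3) show ?thesis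
  proof cases
    case (rf_Pair \<sigma>1 A A' \<tau>1 B B')
    show ?thesis unfolding rf_Pair(1-3)
      by (rule tranclp_map2[OF rf_Pair(4,5) right[OF rf_Pair(4)] left[OF rf_Pair(5)]])
        (auto intro: compat refine.rf_Pair)
  next
    case (rf_Cons \<sigma>1 A A' B B')
    show ?thesis unfolding rf_Cons(1-3)
      by (rule tranclp_map2[OF rf_Cons(4,5) right[OF rf_Cons(4)] left[OF rf_Cons(5)]])
        (auto intro: compat refine.rf_Cons)
  next
    case (rf_Lam x \<sigma>1 \<tau>1 A A')
    show ?thesis unfolding rf_Lam(1-3)
      by (rule tranclp_map[OF rf_Lam(4)]) (auto intro: compat refine.rf_Lam)
  next
    case (rf_Fix x \<sigma>1 \<tau>1 A A')
    show ?thesis unfolding rf_Fix(1-3)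
      by (rule tranclp_map[OF rf_Fix(4)]) (auto intro: compat refine.rf_Fix)
  next
    case (rf_Choice A A' B B')
    show ?thesis unfolding rf_Choice(1-2)
      by (rule tranclp_map2[OF rf_Choice(3,4) right[OF rf_Choice(3)] left[OF rf_Choice(4)]])
        (auto intro: compat refine.rf_Choice)
  next
    case (rf_If L L' A A' B B')
    show ?thesis unfolding rf_If(1-2)
      by (rule tranclp_map3[OF rf_If(3-5) right[OF rf_If(3)] left[OF rf_If(4)] right[OF rf_If(4)] left[OF rf_If(5)]])
        (auto intro: compat refine.rf_If)
  next
    case (rf_Op A A' B B' f)
    show ?thesis unfolding rf_Op(1-3)
      by (rule tranclp_map2[OF rf_Op(4,5) right[OF rf_Op(4)] left[OF rf_Op(5)]])
        (auto intro: compat refine.rf_Op)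
  next
    case (rf_Fst \<tau>1 A A')
    show ?thesis unfolding rf_Fst(1-2)
      by (rule tranclp_map[OF rf_Fst(3)]) (auto intro: compat refine.rf_Fst)
  next
    case (rf_Snd \<sigma>1 A A')
    show ?thesis unfolding rf_Snd(1-2)
      by (rule tranclp_map[OF rf_Snd(3)]) (auto intro: compat refine.rf_Snd)
  next
    case (rf_Case \<sigma>1 L L' A A' h t B B')
    show ?thesis unfolding rf_Case(1-2)
      by (rule tranclp_map3[OF rf_Case(3,4,6) right[OF rf_Case(3)] left[OF rf_Case(4)] right[OF rf_Case(4)]
            left[OF rf_Case(6)], where f="\<lambda>L M N. CaseT L M h t N"])
        (blast intro: compat refine.rf_Case[OF _ _ rf_Case(5)])
  next
    case (rf_App \<sigma>1 A A' B B')
    show ?thesis unfolding rf_App(1-2)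
      by (rule tranclp_map2[OF rf_App(3,4) right[OF rf_App(3)] left[OF rf_App(4)]])
        (auto intro: compat refine.rf_App)
  qed (auto intro: compat refine.intros)
qed


section \<open>Open extensions\<close>

lemma closing_subst_empty: "closing_subst fmempty \<theta> \<longleftrightarrow> \<theta> = Map.empty"
  by (auto simp: closing_subst_def fun_eq_iff)

lemma open_extension_closed:
  "open_extension R fmempty \<sigma> M N \<longleftrightarrow>
    fmempty \<turnstile> M \<Colon> \<sigma> \<and> fmempty \<turnstile> N \<Colon> \<sigma> \<and> (TState M \<sigma>, TState N \<sigma>) \<in> R"
  by (auto simp: open_extension_def closing_subst_empty)

lemma open_extension_typing:
  "open_extension R \<Gamma> \<sigma> M N \<Longrightarrow> \<Gamma> \<turnstile> M \<Colon> \<sigma> \<and> \<Gamma> \<turnstile> N \<Colon> \<sigma>"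
  by (simp add: open_extension_def)

lemma open_extension_refl:
  assumes "refl_on states R" "\<Gamma> \<turnstile> M \<Colon> \<sigma>"
  shows "open_extension R \<Gamma> \<sigma> M M"
  using assms typing_subst[OF assms(2) closing_typed_subst]
  by (auto simp: open_extension_def refl_on_def)

lemma open_extension_trans:
  "trans R \<Longrightarrow> open_extension R \<Gamma> \<sigma> L M \<Longrightarrow> open_extension R \<Gamma> \<sigma> M N \<Longrightarrow> open_extension R \<Gamma> \<sigma> L N"
  unfolding open_extension_def by (blast dest: transD)

lemma open_extension_sym:
  "sym R \<Longrightarrow> open_extension R \<Gamma> \<sigma> M N \<Longrightarrow> open_extension R \<Gamma> \<sigma> N M"
  unfolding open_extension_def by (blast dest: symD)

lemma open_extension_subst:
  assumes MN: "open_extension R \<Gamma> \<sigma> M N" and \<theta>: "typed_subst \<Gamma> \<theta> \<Delta>"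
  shows "open_extension R \<Delta> \<sigma> (subst \<theta> M) (subst \<theta> N)"
proof -
  have ty: "\<Gamma> \<turnstile> M \<Colon> \<sigma>" "\<Gamma> \<turnstile> N \<Colon> \<sigma>" using open_extension_typing[OF MN] by auto
  have "(TState (subst \<eta> (subst \<theta> M)) \<sigma>, TState (subst \<eta> (subst \<theta> N)) \<sigma>) \<in> R" if \<eta>: "closing_subst \<Delta> \<eta>" for \<eta>
  proof -
    \<comment> \<open>A closing substitution must be undefined outside its environment, so the
      composite is restricted to the domain of \<open>\<Gamma>\<close>; on terms typed in
      \<open>\<Gamma>\<close> this changes nothing.\<close>
    define \<zeta> where "\<zeta> = (\<lambda>x. if x \<in> fmdom' \<Gamma> then (\<eta> ++ \<theta>) x else None)"
    have "rel_option (\<lambda>\<tau> V. V \<in> closed_values \<tau>) (fmlookup \<Gamma> x) (\<zeta> x)" for x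
    proof (cases "fmlookup \<Gamma> x")
      case None
      then show ?thesis by (simp add: \<zeta>_def fmdom'_notI)
    next
      case (Some \<tau>)
      then have x: "x \<in> fmdom' \<Gamma>" by (rule fmdom'I)
      have "rel_option (\<lambda>\<tau> V. V \<in> closed_values \<tau>) (fmlookup \<Delta> x) (\<eta> x)"
        using \<eta> by (simp add: closing_subst_def)
      then show ?thesis
        using Some x typed_substD[OF \<theta> Some] by (cases "\<theta> x") (auto simp: \<zeta>_def map_add_def)
    qed
    then have "closing_subst \<Gamma> \<zeta>" by (simp add: closing_subst_def)
    then have "(TState (subst \<zeta> M) \<sigma>, TState (subst \<zeta> N) \<sigma>) \<in> R"
      using MN by (simp add: open_extension_def)
    moreover have "subst \<eta> (subst \<theta> X) = subst \<zeta> X" if "\<Gamma> \<turnstile> X \<Colon> \<sigma>" for X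
      unfolding subst_subst[OF that \<theta>] by (rule subst_cong[OF that]) (simp add: \<zeta>_def)
    ultimately show ?thesis using ty by simp
  qed
  with typing_subst[OF ty(1) \<theta>] typing_subst[OF ty(2) \<theta>] show ?thesis
    by (simp add: open_extension_def)
qed


section \<open>Howe's method\<close>

text \<open>The second assumption is the converse of \<open>presim_values\<close>. It is used once,
  to append an \<open>R\<close>-step between value states to the Howe closure, which relates values
  as terms.\<close>

locale howe =
  fixes R :: "'op::operators state rel"
  assumes sim: "simulation R"
    and value_as_term: "(VState V \<sigma>, VState W \<sigma>) \<in> R \<Longrightarrow> (TState V \<sigma>, TState W \<sigma>) \<in> R"
begin

lemma presim_R: "presim R"
  and trans_R: "trans R"
  and refl_R: "refl_on states R"
  using sim by (auto simp: simulation_iff_presim presim_def)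

abbreviation Ro :: "'op typed_rel" where
  "Ro \<equiv> open_extension R"

text \<open>Appending \<open>Ro\<close> after a refinement makes the closure absorb
  \<open>Ro\<close> on the right by transitivity, and this same one-sidedness breaks
  symmetry.\<close>

inductive H :: "'op typed_rel" where
  HI: "refine H \<Gamma> \<sigma> M M' \<Longrightarrow> Ro \<Gamma> \<sigma> M' N \<Longrightarrow> H \<Gamma> \<sigma> M N"

lemma H_typing: "H \<Gamma> \<sigma> M N \<Longrightarrow> \<Gamma> \<turnstile> M \<Colon> \<sigma> \<and> \<Gamma> \<turnstile> N \<Colon> \<sigma>"
proof (induction rule: H.induct)
  case (HI \<Gamma> \<sigma> M M' N)
  then show ?case using refine_typing[OF HI(1)] open_extension_typing[OF HI(2)] by auto
qed

lemma H_Ro: "H \<Gamma> \<sigma> L M \<Longrightarrow> Ro \<Gamma> \<sigma> M N \<Longrightarrow> H \<Gamma> \<sigma> L N"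
  by (auto elim!: H.cases intro!: HI intro: open_extension_trans[OF trans_R])

lemma H_compatible: "refine H \<Gamma> \<sigma> M N \<Longrightarrow> H \<Gamma> \<sigma> M N"
  using refine_typing[of H \<Gamma> \<sigma> M N] H_typing by (blast intro: HI open_extension_refl[OF refl_R])

lemma H_refl: "\<Gamma> \<turnstile> M \<Colon> \<sigma> \<Longrightarrow> H \<Gamma> \<sigma> M M"
  by (induction rule: typing.induct) (blast intro: H_compatible refine.intros)+

lemma Ro_imp_H: "Ro \<Gamma> \<sigma> M N \<Longrightarrow> H \<Gamma> \<sigma> M N"
  using H_Ro H_refl open_extension_typing by blast


subsection \<open>Substitutivity\<close>

text \<open>Asking for related values over every environment spares a separate proof of weakening.\<close>

definition related_subst :: "tyenv \<Rightarrow> (var \<rightharpoonup> 'op tm) \<Rightarrow> (var \<rightharpoonup> 'op tm) \<Rightarrow> tyenv \<Rightarrow> bool" where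
  "related_subst \<Gamma> \<theta> \<theta>' \<Delta> \<longleftrightarrow> (\<forall>x \<tau>. fmlookup \<Gamma> x = Some \<tau> \<longrightarrow>
     (\<theta> x = None \<and> \<theta>' x = None \<and> fmlookup \<Delta> x = Some \<tau>) \<or>
     (\<exists>V V'. \<theta> x = Some V \<and> \<theta>' x = Some V' \<and> V' \<in> closed_values \<tau> \<and> (\<forall>\<Delta>. H \<Delta> \<tau> V V')))"

lemma related_subst_upd:
  "related_subst \<Gamma> \<theta> \<theta>' \<Delta> \<Longrightarrow> related_subst (fmupd x \<sigma> \<Gamma>) (\<theta>(x := None)) (\<theta>'(x := None)) (fmupd x \<sigma> \<Delta>)"
  by (auto simp: related_subst_def)

lemma related_typed_subst: "related_subst \<Gamma> \<theta> \<theta>' \<Delta> \<Longrightarrow> typed_subst \<Gamma> \<theta>' \<Delta>"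
  unfolding related_subst_def typed_subst_def by fastforce

text \<open>Both substitutions act on the refinement layer, but only \<open>\<theta>'\<close> acts
  on the \<open>Ro\<close> step. Hence closed values are demanded of the right-hand components
  alone.\<close>

lemma H_subst:
  "H \<Gamma> \<sigma> M N \<Longrightarrow> related_subst \<Gamma> \<theta> \<theta>' \<Delta> \<Longrightarrow> H \<Delta> \<sigma> (subst \<theta> M) (subst \<theta>' N)"
proof (induction arbitrary: \<theta> \<theta>' \<Delta> rule: H.induct)
  case (HI \<Gamma> \<sigma> M M' N)
  note upd = related_subst_upd[OF HI.prems] related_subst_upd[OF related_subst_upd[OF HI.prems]]
  have "H \<Delta> \<sigma> (subst \<theta> M) (subst \<theta>' M')"
    using HI(1)
  proof cases
    case (rf_Var x)
    then consider "\<theta> x = None" "\<theta>' x = None" "fmlookup \<Delta> x = Some \<sigma>"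
      | V V' where "\<theta> x = Some V" "\<theta>' x = Some V'" "H \<Delta> \<sigma> V V'"
      using HI.prems[unfolded related_subst_def, rule_format, OF rf_Var(3)] by auto
    then show ?thesis
      by cases (use rf_Var in \<open>auto intro: H_compatible refine.rf_Var\<close>)
  next
    case (rf_Lam x \<sigma>1 \<tau> A A')
    have "refine H \<Delta> \<sigma> (subst \<theta> (Lam x A)) (subst \<theta>' (Lam x A'))"
      unfolding subst.simps rf_Lam(1) by (rule refine.rf_Lam) (use rf_Lam(4) upd(1) in blast)
    then show ?thesis using rf_Lam by (auto intro: H_compatible)
  next
    case (rf_Fix x \<sigma>1 \<tau> A A')
    have "refine H \<Delta> \<sigma> (subst \<theta> (Fix x A)) (subst \<theta>' (Fix x A'))"
      unfolding subst.simps rf_Fix(1) by (rule refine.rf_Fix) (use rf_Fix(4) upd(1) in blast)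
    then show ?thesis using rf_Fix by (auto intro: H_compatible)
  next
    case (rf_Case \<sigma>1 L L' A A' h t B B')
    have "refine H \<Delta> \<sigma> (subst \<theta> (CaseT L A h t B)) (subst \<theta>' (CaseT L' A' h t B'))"
      unfolding subst.simps
      by (rule refine.rf_Case[where \<sigma>=\<sigma>1]) (use rf_Case(3-6) HI.prems upd(2) in blast)+
    then show ?thesis using rf_Case by (auto intro: H_compatible)
  next
    case (rf_App \<sigma>1 A A' B B')
    have "refine H \<Delta> \<sigma> (subst \<theta> (App A B)) (subst \<theta>' (App A' B'))"
      unfolding subst.simps by (rule refine.rf_App[where \<sigma>=\<sigma>1]) (use rf_App(3,4) HI.prems in blast)+
    then show ?thesis using rf_App by (auto intro: H_compatible)
  next
    case (rf_Fst \<tau> A A')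
    have "refine H \<Delta> \<sigma> (subst \<theta> (Fst A)) (subst \<theta>' (Fst A'))"
      unfolding subst.simps by (rule refine.rf_Fst[where \<tau>=\<tau>]) (use rf_Fst(3) HI.prems in blast)
    then show ?thesis using rf_Fst by (auto intro: H_compatible)
  next
    case (rf_Snd \<sigma>1 A A')
    have "refine H \<Delta> \<sigma> (subst \<theta> (Snd A)) (subst \<theta>' (Snd A'))"
      unfolding subst.simps by (rule refine.rf_Snd[where \<sigma>=\<sigma>1]) (use rf_Snd(3) HI.prems in blast)
    then show ?thesis using rf_Snd by (auto intro: H_compatible)
  qed (simp only: subst.simps, rule H_compatible, rule refine.intros; use HI.prems in blast)+
  moreover have "Ro \<Delta> \<sigma> (subst \<theta>' M') (subst \<theta>' N)"
    by (rule open_extension_subst[OF HI(2) related_typed_subst[OF HI.prems]])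
  ultimately show ?case by (rule H_Ro)
qed

lemma H_weaken: "H fmempty \<sigma> M N \<Longrightarrow> H \<Gamma> \<sigma> M N"
  using H_subst[of fmempty \<sigma> M N Map.empty Map.empty \<Gamma>] by (simp add: related_subst_def)

definition HV :: "ty \<Rightarrow> 'op tm rel" where
  "HV \<sigma> = {(V, W). V \<in> closed_values \<sigma> \<and> W \<in> closed_values \<sigma> \<and> H fmempty \<sigma> V W}"

lemma HV_D:
  assumes "(V, W) \<in> HV \<sigma>"
  shows "V \<in> closed_values \<sigma>" "W \<in> closed_values \<sigma>" "H fmempty \<sigma> V W"
  using assms by (auto simp: HV_def)

lemma HV_I: "H fmempty \<sigma> V W \<Longrightarrow> is_value V \<Longrightarrow> is_value W \<Longrightarrow> (V, W) \<in> HV \<sigma>"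
  using H_typing by (auto simp: HV_def closed_values_def)

lemma H_subst1:
  "H (fmupd x \<sigma> fmempty) \<tau> M N \<Longrightarrow> (V, W) \<in> HV \<sigma> \<Longrightarrow> H fmempty \<tau> (subst [x \<mapsto> V] M) (subst [x \<mapsto> W] N)"
  by (erule H_subst) (auto simp: related_subst_def HV_def intro: H_weaken)

lemma H_subst2:
  "H (fmupd t \<rho> (fmupd h \<sigma> fmempty)) \<tau> M N \<Longrightarrow> h \<noteq> t \<Longrightarrow> (V, W) \<in> HV \<sigma> \<Longrightarrow> (V', W') \<in> HV \<rho> \<Longrightarrow>
    H fmempty \<tau> (subst [h \<mapsto> V, t \<mapsto> V'] M) (subst [h \<mapsto> W, t \<mapsto> W'] N)"
  by (erule H_subst) (auto simp: related_subst_def HV_def intro: H_weaken)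


subsection \<open>Inversion on related values\<close>

lemma R_Num: "(VState (Num k) TInt, VState W TInt) \<in> R \<Longrightarrow> W = Num k"
  by (erule presim_dtrans[OF presim_R _ dtrans.intros(6)])
    (auto simp: closed_values_def intro: typing.intros elim: dtrans.cases)

lemma R_Bool: "(VState (Bool b) TBool, VState W TBool) \<in> R \<Longrightarrow> W = Bool b"
  by (erule presim_dtrans[OF presim_R _ dtrans.intros(7)])
    (auto simp: closed_values_def intro: typing.intros elim: dtrans.cases)

lemma R_Nil: "(VState NilT (TList \<tau>), VState W (TList \<tau>)) \<in> R \<Longrightarrow> W = NilT"
  by (erule presim_dtrans[OF presim_R _ dtrans.intros(8)])
    (auto simp: closed_values_def intro: typing.intros elim: dtrans.cases)

lemma R_Pair:
  assumes "(VState (PairT M N) (TProd \<sigma> \<tau>), VState W (TProd \<sigma> \<tau>)) \<in> R"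
  obtains M' N' where "W = PairT M' N'" "Ro fmempty \<sigma> M M'" "Ro fmempty \<tau> N N'"
proof -
  have cv: "PairT M N \<in> closed_values (TProd \<sigma> \<tau>)" "W \<in> closed_values (TProd \<sigma> \<tau>)"
    using presim_VState[OF presim_R assms] by auto
  then have M: "fmempty \<turnstile> M \<Colon> \<sigma>" "fmempty \<turnstile> N \<Colon> \<tau>" by (auto elim: closed_values_TProd)
  obtain M' N' where W: "W = PairT M' N'" "fmempty \<turnstile> M' \<Colon> \<sigma>" "fmempty \<turnstile> N' \<Colon> \<tau>"
    using cv(2) by (rule closed_values_TProd)
  obtain y where "dtrans (VState W (TProd \<sigma> \<tau>)) LFst y" "(TState M \<sigma>, y) \<in> R"
    by (rule presim_dtrans[OF presim_R assms dtrans.intros(4)]) (simp add: M)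
  moreover obtain z where "dtrans (VState W (TProd \<sigma> \<tau>)) LSnd z" "(TState N \<tau>, z) \<in> R"
    by (rule presim_dtrans[OF presim_R assms dtrans.intros(5)]) (simp add: M)
  ultimately have "(TState M \<sigma>, TState M' \<sigma>) \<in> R" "(TState N \<tau>, TState N' \<tau>) \<in> R"
    using W(1) by (auto elim: dtrans.cases)
  with M W show thesis by (intro that) (auto simp: open_extension_closed)
qed

lemma R_Cons:
  assumes "(VState (ConsT M N) (TList \<sigma>), VState W (TList \<sigma>)) \<in> R"
  obtains M' N' where "W = ConsT M' N'" "Ro fmempty \<sigma> M M'" "Ro fmempty (TList \<sigma>) N N'"
proof -
  have cv: "ConsT M N \<in> closed_values (TList \<sigma>)" "W \<in> closed_values (TList \<sigma>)"
    using presim_VState[OF presim_R assms] by auto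
  then have M: "fmempty \<turnstile> M \<Colon> \<sigma>" "fmempty \<turnstile> N \<Colon> TList \<sigma>" by (auto elim: closed_values_TList)
  obtain y where y: "dtrans (VState W (TList \<sigma>)) LHd y" "(TState M \<sigma>, y) \<in> R"
    by (rule presim_dtrans[OF presim_R assms dtrans.intros(9)]) (simp add: M)
  obtain z where z: "dtrans (VState W (TList \<sigma>)) LTl z" "(TState N (TList \<sigma>), z) \<in> R"
    by (rule presim_dtrans[OF presim_R assms dtrans.intros(10)]) (simp add: M)
  from y(1) obtain M' N' where W: "W = ConsT M' N'" by (auto elim: dtrans.cases)
  have "(TState M \<sigma>, TState M' \<sigma>) \<in> R" "(TState N (TList \<sigma>), TState N' (TList \<sigma>)) \<in> R"
    using y z W by (auto elim: dtrans.cases)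
  moreover have "fmempty \<turnstile> M' \<Colon> \<sigma>" "fmempty \<turnstile> N' \<Colon> TList \<sigma>"
    using cv(2) W by (auto elim: closed_values_TList)
  ultimately show thesis using M W by (intro that) (auto simp: open_extension_closed)
qed

lemma dtrans_beta:
  assumes "V \<in> closed_values (TFun \<sigma> \<tau>)" "U \<in> closed_values \<sigma>"
  shows "dtrans (VState V (TFun \<sigma> \<tau>)) (LVal U) (TState (beta V U) \<tau>)"
  using assms(1) by (cases rule: closed_values_TFun) (use assms(2) in \<open>auto intro: dtrans.intros\<close>)

lemma R_Fun:
  assumes "(VState V (TFun \<sigma> \<tau>), VState W (TFun \<sigma> \<tau>)) \<in> R" "U \<in> closed_values \<sigma>"
  shows "Ro fmempty \<tau> (beta V U) (beta W U)"
proof -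
  have cv: "V \<in> closed_values (TFun \<sigma> \<tau>)" "W \<in> closed_values (TFun \<sigma> \<tau>)"
    using presim_VState[OF presim_R assms(1)] by auto
  note ty = beta_typing[OF cv(1) assms(2)] beta_typing[OF cv(2) assms(2)]
  obtain y where "dtrans (VState W (TFun \<sigma> \<tau>)) (LVal U) y" "(TState (beta V U) \<tau>, y) \<in> R"
    by (rule presim_dtrans[OF presim_R assms(1) dtrans_beta[OF cv(1) assms(2)]]) (simp add: ty)
  with dtrans_deterministic[OF dtrans_beta[OF cv(2) assms(2)]] ty show ?thesis
    by (auto simp: open_extension_closed)
qed

text \<open>Refinement preserves the outermost constructor, so the intermediate term is a value too,
  and the \<open>Ro\<close> step can be read off at value states, where the applicative tests are
  available.\<close>

lemma HV_refine:
  assumes "(V, W) \<in> HV \<sigma>"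
  obtains U where "refine H fmempty \<sigma> V U" "(VState U \<sigma>, VState W \<sigma>) \<in> R"
proof -
  from HV_D(3)[OF assms] obtain U where U: "refine H fmempty \<sigma> V U" "Ro fmempty \<sigma> U W"
    by (auto elim: H.cases)
  have "is_value U" "is_value W"
    using refine_is_value[OF U(1)] HV_D[OF assms] by (auto dest: closed_valuesD)
  then have "(VState U \<sigma>, VState W \<sigma>) \<in> R"
    using U(2) by (intro presim_values[OF presim_R]) (auto simp: open_extension_closed)
  with U(1) show thesis by (rule that)
qed

lemma HV_TInt: "(V, W) \<in> HV TInt \<Longrightarrow> \<exists>k. V = Num k \<and> W = Num k"
  by (frule HV_D(1), erule closed_values_TInt, erule HV_refine) (auto elim: refine.cases dest: R_Num)

lemma HV_TBool: "(V, W) \<in> HV TBool \<Longrightarrow> \<exists>b. V = Bool b \<and> W = Bool b"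
  by (frule HV_D(1), erule closed_values_TBool, erule HV_refine) (auto elim: refine.cases dest: R_Bool)

lemma HV_TProd:
  assumes "(V, W) \<in> HV (TProd \<sigma> \<tau>)"
  obtains M N M' N' where "V = PairT M N" "W = PairT M' N'" "H fmempty \<sigma> M M'" "H fmempty \<tau> N N'"
proof -
  obtain U where U: "refine H fmempty (TProd \<sigma> \<tau>) V U" "(VState U (TProd \<sigma> \<tau>), VState W (TProd \<sigma> \<tau>)) \<in> R"
    using assms by (rule HV_refine)
  from HV_D(1)[OF assms] obtain M N where V: "V = PairT M N" by (rule closed_values_TProd)
  with U(1) obtain M1 N1 where "U = PairT M1 N1" "H fmempty \<sigma> M M1" "H fmempty \<tau> N N1"
    by (auto elim: refine.cases)
  with U(2) V show thesis by (auto elim!: R_Pair intro: that H_Ro)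
qed

lemma HV_TList:
  assumes "(V, W) \<in> HV (TList \<sigma>)"
  obtains "V = NilT" "W = NilT"
    | M N M' N' where "V = ConsT M N" "W = ConsT M' N'" "H fmempty \<sigma> M M'" "H fmempty (TList \<sigma>) N N'"
proof -
  obtain U where U: "refine H fmempty (TList \<sigma>) V U" "(VState U (TList \<sigma>), VState W (TList \<sigma>)) \<in> R"
    using assms by (rule HV_refine)
  from HV_D(1)[OF assms] show thesis
  proof (cases rule: closed_values_TList)
    case 1
    with U(1) have "U = NilT" by (auto elim: refine.cases)
    with U(2) 1 show thesis by (auto intro: that(1) dest: R_Nil)
  next
    case (2 M N)
    with U(1) obtain M1 N1 where "U = ConsT M1 N1" "H fmempty \<sigma> M M1" "H fmempty (TList \<sigma>) N N1"
      by (auto elim: refine.cases)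
    with U(2) 2 show thesis by (auto elim!: R_Cons intro: that(2) H_Ro)
  qed
qed

text \<open>Body and argument change together along the refinement, by substitutivity; afterwards
  the function changes along \<open>R\<close> with the argument \<open>U'\<close> fixed, since
  simulation tests both sides on the same argument.\<close>

lemma HV_TFun:
  assumes VW: "(V, W) \<in> HV (TFun \<sigma> \<tau>)" and UU': "(U, U') \<in> HV \<sigma>"
  shows "H fmempty \<tau> (beta V U) (beta W U')"
proof -
  obtain Z where Z: "refine H fmempty (TFun \<sigma> \<tau>) V Z" "(VState Z (TFun \<sigma> \<tau>), VState W (TFun \<sigma> \<tau>)) \<in> R"
    using VW by (rule HV_refine)
  from HV_D(1)[OF VW] have "H fmempty \<tau> (beta V U) (beta Z U')"
  proof (cases rule: closed_values_TFun)
    case (1 x M)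
    with Z(1) obtain M' where "Z = Lam x M'" "H (fmupd x \<sigma> fmempty) \<tau> M M'"
      by (auto elim: refine.cases)
    with 1 show ?thesis using H_subst1[OF _ UU'] by simp
  next
    case (2 x M)
    with Z(1) obtain M' where M': "Z = Fix x M'" "H (fmupd x (TFun \<sigma> \<tau>) fmempty) (TFun \<sigma> \<tau>) M M'"
      by (auto elim: refine.cases)
    \<comment> \<open>Unfolding substitutes the recursive functions themselves, so these must be
      related as values before substitutivity applies.\<close>
    then have "(V, Z) \<in> HV (TFun \<sigma> \<tau>)" using 2 Z(1) by (auto intro: HV_I H_compatible)
    from H_subst1[OF M'(2) this] have
      "H fmempty (TFun \<sigma> \<tau>) (subst [x \<mapsto> V] M) (subst [x \<mapsto> Z] M')" .
    then have "H fmempty \<tau> (App (subst [x \<mapsto> V] M) U) (App (subst [x \<mapsto> Z] M') U')"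
      using HV_D(3)[OF UU'] by (blast intro: H_compatible refine.rf_App)
    then show ?thesis using 2 M' by simp
  qed
  moreover have "Ro fmempty \<tau> (beta Z U') (beta W U')"
    by (rule R_Fun[OF Z(2) HV_D(2)[OF UU']])
  ultimately show ?thesis by (rule H_Ro)
qed


subsection \<open>The key lemma\<close>

lemma HV_value_rel: "HV \<sigma> O value_rel R \<sigma> \<subseteq> HV \<sigma>"
proof safe
  fix V W U assume *: "(V, W) \<in> HV \<sigma>" "(W, U) \<in> value_rel R \<sigma>"
  then have "Ro fmempty \<sigma> W U"
    by (auto simp: value_rel_def open_extension_closed dest: closed_valuesD intro: value_as_term)
  with * show "(V, U) \<in> HV \<sigma>" by (auto simp: HV_def value_rel_def intro: H_Ro)
qed

text \<open>The evaluation of the intermediate term \<open>M'\<close> is compared layer by layer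
  with that of \<open>M\<close>, the inversion lemmas supplying related contracta; the semantic
  comparison of \<open>M'\<close> with \<open>N\<close> is then composed on the right.\<close>

lemma lift_ev:
  assumes "H fmempty \<sigma> M N"
  shows "lift (HV \<sigma>) (ev n M) (sem N)"
  using assms
proof (induction n arbitrary: \<sigma> M N)
  case 0
  show ?case by (simp add: lift_zero)
next
  case (Suc n)
  from Suc.prems obtain M' where M': "refine H fmempty \<sigma> M M'" "Ro fmempty \<sigma> M' N"
    by (auto elim: H.cases)
  have "lift (HV \<sigma>) (ev (Suc n) M) (sem M')"
  proof (cases "is_value M")
    case True
    then have "is_value M'" using refine_is_value[OF M'(1)] by simp
    with True show ?thesis
      by (simp add: sem_value lift_dirac HV_I H_compatible[OF M'(1)])
  next
    case False
    from M'(1) show ?thesis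
    proof cases
      case (rf_Choice A A' B B')
      then show ?thesis by (simp only: ev_Suc sem_Choice) (intro lift_convex Suc.IH)
    next
      case (rf_If L L' A A' B B')
      have "lift (HV \<sigma>) (ev n (branch V A B)) (sem (branch W A' B'))" if "(V, W) \<in> HV TBool" for V W
        using HV_TBool[OF that] rf_If by (auto intro: Suc.IH)
      then show ?thesis
        unfolding rf_If(1,2) ev_Suc sem_elim by (rule lift_bind[OF Suc.IH[OF rf_If(3)]])
    next
      case (rf_Op A A' B B' f)
      have "lift (HV \<sigma>) (ev n (delta f V V')) (sem (delta f W W'))"
        if "(V, W) \<in> HV TInt" "(V', W') \<in> HV TInt" for V V' W W'
      proof (rule Suc.IH)
        \<comment> \<open>Related integers are the same numeral, so both sides contract to the same
          closed term and reflexivity suffices.\<close>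
        have "delta f W W' = delta f V V'" using HV_TInt[OF that(1)] HV_TInt[OF that(2)] by auto
        then show "H fmempty \<sigma> (delta f V V') (delta f W W')"
          using delta_typing[OF that[THEN HV_D(1)], of f] rf_Op(1) by (simp add: H_refl)
      qed
      then show ?thesis
        unfolding rf_Op(2,3) ev_Suc sem_elim
        by (intro lift_bind[OF Suc.IH[OF rf_Op(4)]] lift_bind[OF Suc.IH[OF rf_Op(5)]])
    next
      case (rf_Fst \<tau> A A')
      have "lift (HV \<sigma>) (ev n (fst_of V)) (sem (fst_of W))" if "(V, W) \<in> HV (TProd \<sigma> \<tau>)" for V W
        using that by (rule HV_TProd) (simp add: Suc.IH)
      then show ?thesis
        unfolding rf_Fst(1,2) ev_Suc sem_elim by (rule lift_bind[OF Suc.IH[OF rf_Fst(3)]])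
    next
      case (rf_Snd \<tau> A A')
      have "lift (HV \<sigma>) (ev n (snd_of V)) (sem (snd_of W))" if "(V, W) \<in> HV (TProd \<tau> \<sigma>)" for V W
        using that by (rule HV_TProd) (simp add: Suc.IH)
      then show ?thesis
        unfolding rf_Snd(1,2) ev_Suc sem_elim by (rule lift_bind[OF Suc.IH[OF rf_Snd(3)]])
    next
      case (rf_Case \<rho> L L' A A' h t B B')
      let ?F = "\<lambda>B V W. subst [h \<mapsto> V, t \<mapsto> W] B"
      have *: "lift (HV \<sigma>) (ev n (?F B V V')) (sem (?F B' W W'))"
        if "(V, W) \<in> HV \<rho>" "(V', W') \<in> HV (TList \<rho>)" for V V' W W'
        using H_subst2[OF rf_Case(6,5) that] by (rule Suc.IH)
      have "lift (HV \<sigma>) (unfold_list V (ev n) A (?F B)) (unfold_list W sem A' (?F B'))"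
        if "(V, W) \<in> HV (TList \<rho>)" for V W
        using that
      proof (cases rule: HV_TList)
        case 1
        then show ?thesis using Suc.IH[OF rf_Case(4)] by simp
      next
        case (2 X Y X' Y')
        show ?thesis unfolding 2(1,2) unfold_list.simps
          by (intro lift_bind[OF Suc.IH[OF 2(3)]] lift_bind[OF Suc.IH[OF 2(4)]] *)
      qed
      then show ?thesis
        unfolding rf_Case(1,2) ev_Suc sem_elim by (rule lift_bind[OF Suc.IH[OF rf_Case(3)]])
    next
      case (rf_App \<rho> A A' B B')
      show ?thesis
        unfolding rf_App(1,2) ev_Suc sem_elim
        by (intro lift_bind[OF Suc.IH[OF rf_App(3)]] lift_bind[OF Suc.IH[OF rf_App(4)]] Suc.IH HV_TFun)
    qed (use False in auto)
  qed
  moreover have "lift (value_rel R \<sigma>) (sem M') (sem N)"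
    using M'(2) by (intro presim_sem[OF presim_R]) (simp add: open_extension_closed)
  ultimately show ?case using lift_trans lift_mono[OF _ HV_value_rel] by blast
qed

lemma lift_sem: "H fmempty \<sigma> M N \<Longrightarrow> lift (HV \<sigma>) (sem M) (sem N)"
  unfolding sem_fun[of M] by (rule lift_SUP[OF incseq_ev lift_ev])

section \<open>The Howe closure as a simulation on states\<close>

definition howe_states :: "'op state rel" where
  "howe_states = {(TState M \<sigma>, TState N \<sigma>) | M N \<sigma>. H fmempty \<sigma> M N} \<union>
     {(VState V \<sigma>, VState W \<sigma>) | V W \<sigma>. (V, W) \<in> HV \<sigma>}"

lemma presim_howe_states: "presim howe_states"
  unfolding presim_def
proof (intro conjI ballI allI impI, safe)
  show "s \<in> states" "t \<in> states" if "(s, t) \<in> howe_states" for s t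
    using that by (auto simp: howe_states_def dest: H_typing HV_D)
  show "refl_on states howe_states"
    by (auto simp: refl_on_def states_def howe_states_def HV_def closed_values_def intro: H_refl)
  fix s t l and X :: "'op state set" assume "(s, t) \<in> howe_states" and X: "X \<subseteq> states"
  then consider M N \<sigma> where "s = TState M \<sigma>" "t = TState N \<sigma>" "H fmempty \<sigma> M N"
    | V W \<sigma> where "s = VState V \<sigma>" "t = VState W \<sigma>" "(V, W) \<in> HV \<sigma>"
    by (auto simp: howe_states_def)
  then show "prob_set s l X \<le> prob_set t l (howe_states `` X)"
  proof cases
    case 1
    show ?thesis unfolding 1(1,2)
      by (rule prob_set_TState_le[OF lift_sem[OF 1(3)]]) (use 1(3) in \<open>auto simp: howe_states_def\<close>)
  next
    case 2
    note HV = 2(3)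
    have "\<exists>y. (x, y) \<in> howe_states \<and> dtrans (VState W \<sigma>) l y" if "dtrans (VState V \<sigma>) l x" for x
      using that
    proof cases
      case 1
      then show ?thesis
        using HV dtrans.intros(1)[of "VState W \<sigma>"] by (auto simp: howe_states_def)
    next
      case (2 U \<tau> y M \<theta>)
      \<comment> \<open>Both functions are tested on the same argument, which is related to itself
        by reflexivity.\<close>
      then have U: "(U, U) \<in> HV \<tau>" by (auto intro: HV_I H_refl dest: closed_valuesD)
      have x: "x = TState (beta V U) \<theta>" and \<sigma>: "\<sigma> = TFun \<tau> \<theta>" using 2 by auto
      show ?thesis
        using HV_TFun[OF HV[unfolded \<sigma>] U] dtrans_beta[OF HV_D(2)[OF HV[unfolded \<sigma>]] HV_D(1)[OF U]] 2
        unfolding x \<sigma> by (auto simp: howe_states_def)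
    next
      case (3 U \<tau> y M \<theta>)
      then have U: "(U, U) \<in> HV \<tau>" by (auto intro: HV_I H_refl dest: closed_valuesD)
      have x: "x = TState (beta V U) \<theta>" and \<sigma>: "\<sigma> = TFun \<tau> \<theta>" using 3 by auto
      show ?thesis
        using HV_TFun[OF HV[unfolded \<sigma>] U] dtrans_beta[OF HV_D(2)[OF HV[unfolded \<sigma>]] HV_D(1)[OF U]] 3
        unfolding x \<sigma> by (auto simp: howe_states_def)
    next
      case (4 M N \<tau> \<theta>)
      with HV show ?thesis
        by (auto elim!: HV_TProd simp: howe_states_def intro: dtrans.intros)
    next
      case (5 M N \<tau> \<theta>)
      with HV show ?thesis
        by (auto elim!: HV_TProd simp: howe_states_def intro: dtrans.intros)
    next
      case (6 k)
      with HV HV_TInt[of V W] show ?thesis by (auto simp: howe_states_def intro: dtrans.intros)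
    next
      case (7 b)
      with HV HV_TBool[of V W] show ?thesis by (auto simp: howe_states_def intro: dtrans.intros)
    next
      case (8 \<tau>)
      with HV have "W = NilT" by (auto elim!: HV_TList)
      with HV 8 show ?thesis by (auto simp: howe_states_def intro!: dtrans.intros)
    next
      case (9 M N \<tau>)
      with HV show ?thesis by (auto elim!: HV_TList simp: howe_states_def intro: dtrans.intros)
    next
      case (10 M N \<tau>)
      with HV show ?thesis by (auto elim!: HV_TList simp: howe_states_def intro: dtrans.intros)
    qed
    then show ?thesis unfolding 2(1,2) by (intro prob_set_le_dtrans prob_VState) blast
  qed
qed

lemma simulation_howe: "simulation (howe_states\<^sup>+)"
  by (rule presim_trancl[OF presim_howe_states])

lemma H_open_extension:
  assumes "H \<Gamma> \<sigma> M N" "howe_states\<^sup>+ \<subseteq> S"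
  shows "open_extension S \<Gamma> \<sigma> M N"
proof -
  have "(TState (subst \<theta> M) \<sigma>, TState (subst \<theta> N) \<sigma>) \<in> S" if \<theta>: "closing_subst \<Gamma> \<theta>" for \<theta>
  proof -
    have "related_subst \<Gamma> \<theta> \<theta> fmempty"
      using typed_substD[OF closing_typed_subst[OF \<theta>]] unfolding related_subst_def
      by (metis H_refl H_weaken closed_valuesD(2) fmempty_lookup not_Some_eq)
    from H_subst[OF assms(1) this] have "(TState (subst \<theta> M) \<sigma>, TState (subst \<theta> N) \<sigma>) \<in> howe_states"
      by (auto simp: howe_states_def)
    with assms(2) show ?thesis by auto
  qed
  with H_typing[OF assms(1)] show ?thesis by (simp add: open_extension_def)
qed

text \<open>The hypothesis makes \<open>H\<close> and \<open>Ro\<close> coincide: \<open>Ro\<close>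
  is contained in \<open>H\<close> in any case, and \<open>H\<close> now returns to
  \<open>Ro\<close>. Compatibility, which \<open>H\<close> has by construction, is thereby
  inherited.\<close>

lemma compatible_Ro:
  assumes "howe_states\<^sup>+ \<subseteq> R"
  shows "compatible Ro"
  unfolding compatible_iff_refine
  by (blast intro: H_open_extension[OF _ assms] H_compatible refine_imp[of Ro] Ro_imp_H)

text \<open>The \<open>Ro\<close> step can be turned around because \<open>R\<close> is symmetric,
  and costs one step of \<open>H\<close>. The subterms of the refinement are reversed by induction
  only up to transitive closure, so the transitive closure has to be compatible as well.\<close>

lemma H_sym:
  assumes "sym R"
  shows "H \<Gamma> \<sigma> M N \<Longrightarrow> (H \<Gamma> \<sigma>)\<^sup>+\<^sup>+ N M"
proof (induction rule: H.induct)
  case (HI \<Gamma> \<sigma> M M' N)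
  from refine_converse[OF HI(1)] have "refine (\<lambda>\<Gamma> \<sigma>. (H \<Gamma> \<sigma>)\<^sup>+\<^sup>+) \<Gamma> \<sigma> M' M"
    by (rule refine_imp) auto
  then have "(H \<Gamma> \<sigma>)\<^sup>+\<^sup>+ M' M"
    using H_typing H_refl by (intro refine_tranclp H_compatible) blast+
  moreover have "H \<Gamma> \<sigma> N M'" by (rule Ro_imp_H[OF open_extension_sym[OF assms HI(2)]])
  ultimately show ?case by (meson tranclp_into_tranclp2)
qed

lemma sym_howe:
  assumes "sym R"
  shows "sym (howe_states\<^sup>+)"
proof -
  have T: "(TState N \<sigma>, TState M \<sigma>) \<in> howe_states\<^sup>+" if "H fmempty \<sigma> M N" for M N \<sigma>
    using tranclp_map[OF H_sym[OF assms that], of "\<lambda>s t. (s, t) \<in> howe_states" "\<lambda>M. TState M \<sigma>"]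
    by (auto simp: howe_states_def trancl_def)
  \<comment> \<open>The closure is a simulation, so the reversed pair of term states passes to value
    states without a second induction.\<close>
  have V: "(VState W \<sigma>, VState V \<sigma>) \<in> howe_states\<^sup>+" if "(V, W) \<in> HV \<sigma>" for V W \<sigma>
    using T[OF HV_D(3)[OF that]] simulation_howe HV_D[OF that]
    by (intro presim_values) (auto simp: simulation_iff_presim dest: closed_valuesD)
  have "(t, s) \<in> howe_states\<^sup>+" if "(s, t) \<in> howe_states" for s t
    using that T V unfolding howe_states_def by blast
  then have "howe_states\<inverse> \<subseteq> howe_states\<^sup>+" by auto
  then have "(howe_states\<^sup>+)\<inverse> \<subseteq> howe_states\<^sup>+"
    by (metis trancl_converse trancl_id trancl_mono_subset trans_trancl)
  then show ?thesis by (auto simp: sym_def)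
qed

end


section \<open>Soundness for the contextual preorder\<close>

lemmas presim_similarity = simulation_similarity[unfolded simulation_iff_presim, THEN conjunct1]
lemmas trans_similarity = simulation_similarity[unfolded simulation_iff_presim, THEN conjunct2]
lemmas simulation_bisimilarity = bisimulation_bisimilarity[unfolded bisimulation_iff, THEN conjunct1]
lemmas sym_bisimilarity = bisimulation_bisimilarity[unfolded bisimulation_iff, THEN conjunct2]
lemmas presim_bisimilarity = simulation_bisimilarity[unfolded simulation_iff_presim, THEN conjunct1]
lemmas trans_bisimilarity = simulation_bisimilarity[unfolded simulation_iff_presim, THEN conjunct2]

text \<open>Adjoining the term pairs of related values preserves the simulation clause, so by
  maximality similarity contains them already.\<close>

lemma howe_similarity: "howe (similarity :: 'a::operators state rel)"
proof
  show "simulation similarity" by (rule simulation_similarity)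
  fix V W :: "'a tm" and \<sigma>
  assume VW: "(VState V \<sigma>, VState W \<sigma>) \<in> similarity"
  let ?R = "(similarity :: 'a state rel) \<union> {(TState V \<sigma>, TState W \<sigma>) | V W \<sigma>. (VState V \<sigma>, VState W \<sigma>) \<in> similarity}"
  have "simulation (?R\<^sup>+)"
    by (intro presim_trancl presim_value_closure presim_similarity)
  then have "?R\<^sup>+ \<subseteq> similarity" unfolding similarity_def by blast
  with VW show "(TState V \<sigma>, TState W \<sigma>) \<in> similarity" by blast
qed

lemma howe_bisimilarity: "howe (bisimilarity :: 'a::operators state rel)"
proof
  show "simulation bisimilarity" by (rule simulation_bisimilarity)
  fix V W :: "'a tm" and \<sigma>
  assume VW: "(VState V \<sigma>, VState W \<sigma>) \<in> bisimilarity"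
  let ?R = "(bisimilarity :: 'a state rel) \<union> {(TState V \<sigma>, TState W \<sigma>) | V W \<sigma>. (VState V \<sigma>, VState W \<sigma>) \<in> bisimilarity}"
  have "simulation (?R\<^sup>+)"
    by (intro presim_trancl presim_value_closure presim_bisimilarity)
  \<comment> \<open>The adjoined pairs inherit symmetry from the value states.\<close>
  moreover have "sym ?R"
    by (intro symI) (auto dest: symD[OF sym_bisimilarity])
  ultimately have "bisimulation (?R\<^sup>+)" by (simp add: bisimulation_iff sym_trancl)
  then have "?R\<^sup>+ \<subseteq> bisimilarity" unfolding bisimilarity_def by blast
  with VW show "(TState V \<sigma>, TState W \<sigma>) \<in> bisimilarity" by blast
qed

lemma compatible_sim_preorder: "compatible sim_preorder"
proof -
  interpret howe similarity by (rule howe_similarity)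
  have "howe_states\<^sup>+ \<subseteq> similarity" using simulation_howe unfolding similarity_def by blast
  then show ?thesis unfolding sim_preorder_def by (rule compatible_Ro)
qed

lemma compatible_bisim_equiv: "compatible bisim_equiv"
proof -
  interpret howe bisimilarity by (rule howe_bisimilarity)
  have "bisimulation (howe_states\<^sup>+)"
    by (simp add: bisimulation_iff simulation_howe sym_howe sym_bisimilarity)
  then have "howe_states\<^sup>+ \<subseteq> bisimilarity" unfolding bisimilarity_def by blast
  then show ?thesis unfolding bisim_equiv_def by (rule compatible_Ro)
qed

text \<open>The hole may lie below binders that extend the environment, so \<open>M\<close> and
  \<open>N\<close> must be related in every extension of \<open>\<Gamma>\<close>.\<close>

lemma plug_related:
  assumes "compatible R" "\<And>\<Gamma> \<sigma> M. \<Gamma> \<turnstile> M \<Colon> \<sigma> \<Longrightarrow> R \<Gamma> \<sigma> M M"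
    and "\<And>\<Delta>. \<Gamma> \<subseteq>\<^sub>f \<Delta> \<Longrightarrow> R \<Delta> \<tau> M N"
    and "ctx_typing \<Gamma> \<tau> \<Delta> C \<sigma>"
  shows "R \<Delta> \<sigma> (plug C M) (plug C N)"
proof -
  have c: "\<And>\<Gamma> \<sigma> M N. refine R \<Gamma> \<sigma> M N \<Longrightarrow> R \<Gamma> \<sigma> M N"
    using assms(1) by (simp add: compatible_iff_refine)
  from assms(4) show ?thesis
    by induction (simp_all only: plug.simps, (blast intro: c refine.intros assms(2,3))+)
qed

lemma sim_preorder_mass:
  assumes "(TState M \<sigma>, TState N \<sigma>) \<in> similarity"
  shows "mass M \<le> mass N"
proof -
  have "lift (value_rel similarity \<sigma>) (sem M) (sem N)"
    by (rule presim_sem[OF presim_similarity assms])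
  \<comment> \<open>The clause is taken for the set of all values; its image consists of values, so
    the mass there is at most the total mass of \<open>N\<close>.\<close>
  then have "mass M \<le> (\<integral>\<^sup>+V. sem N V \<partial>count_space (value_rel similarity \<sigma> `` {V. is_value V}))"
    unfolding mass_def infsum_eq_nn_integral_count_space by (rule liftD)
  also have "\<dots> \<le> mass N"
    unfolding mass_def infsum_eq_nn_integral_count_space
    by (rule nn_integral_count_space_mono_set) (auto simp: value_rel_def dest: closed_valuesD)
  finally show ?thesis .
qed

lemma sim_preorder_refl: "\<Gamma> \<turnstile> M \<Colon> \<sigma> \<Longrightarrow> sim_preorder \<Gamma> \<sigma> M M"
  unfolding sim_preorder_def
  by (rule open_extension_refl[OF presim_similarity[unfolded presim_def, THEN conjunct2, THEN conjunct1]])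

lemma sim_preorder_imp_ctx_preorder:
  assumes "sim_preorder \<Gamma> \<tau> M N"
  shows "ctx_preorder \<Gamma> \<tau> M N"
proof -
  have "mass (plug C M) \<le> mass (plug C N)" if C: "ctx_typing \<Gamma> \<tau> fmempty C \<sigma>" for C \<sigma>
  proof -
    \<comment> \<open>Weakening is substitution by the empty map.\<close>
    have "sim_preorder \<Delta> \<tau> M N" if "\<Gamma> \<subseteq>\<^sub>f \<Delta>" for \<Delta>
      using open_extension_subst[OF assms[unfolded sim_preorder_def], of Map.empty \<Delta>] that
      by (simp add: sim_preorder_def typed_subst_def fmsubset_lookup)
    from plug_related[OF compatible_sim_preorder sim_preorder_refl this C]
    have "sim_preorder fmempty \<sigma> (plug C M) (plug C N)" .
    then show ?thesis
      by (auto simp: sim_preorder_def open_extension_closed intro: sim_preorder_mass)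
  qed
  with assms show ?thesis
    by (auto simp: ctx_preorder_def sim_preorder_def dest: open_extension_typing)
qed

lemma bisim_equiv_sym: "bisim_equiv \<Gamma> \<sigma> M N \<Longrightarrow> bisim_equiv \<Gamma> \<sigma> N M"
  unfolding bisim_equiv_def by (rule open_extension_sym[OF sym_bisimilarity])

lemma bisim_equiv_imp_sim_preorder: "bisim_equiv \<Gamma> \<sigma> M N \<Longrightarrow> sim_preorder \<Gamma> \<sigma> M N"
  using bisimilarity_subset_similarity by (auto simp: bisim_equiv_def sim_preorder_def open_extension_def)

lemma typed_relation_open_extension: "typed_relation (open_extension R)"
  by (auto simp: typed_relation_def dest: open_extension_typing)

lemma transp_open_extension: "trans R \<Longrightarrow> transp (open_extension R \<Gamma> \<sigma>)"
  by (rule transpI) (rule open_extension_trans)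

theorem mainTheorem1:
  shows "precongruence (sim_preorder :: 'op::operators typed_rel) \<and>
    (\<forall>\<Gamma> \<sigma> (M :: 'op tm) N. sim_preorder \<Gamma> \<sigma> M N \<longrightarrow> ctx_preorder \<Gamma> \<sigma> M N) \<and>
    congruence (bisim_equiv :: 'op typed_rel) \<and>
    (\<forall>\<Gamma> \<sigma> (M :: 'op tm) N. bisim_equiv \<Gamma> \<sigma> M N \<longrightarrow> ctx_equiv \<Gamma> \<sigma> M N)"
proof (intro conjI allI impI)
  show "precongruence (sim_preorder :: 'op typed_rel)"
    using compatible_sim_preorder
    by (simp add: precongruence_def sim_preorder_def typed_relation_open_extension
        transp_open_extension[OF trans_similarity])
  show "congruence (bisim_equiv :: 'op typed_rel)"
    using compatible_bisim_equiv bisim_equiv_sym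
    by (auto simp: congruence_def bisim_equiv_def typed_relation_open_extension
        transp_open_extension[OF trans_bisimilarity] intro!: sympI)
  fix \<Gamma> \<sigma> and M N :: "'op tm"
  show "sim_preorder \<Gamma> \<sigma> M N \<Longrightarrow> ctx_preorder \<Gamma> \<sigma> M N" by (rule sim_preorder_imp_ctx_preorder)
  assume "bisim_equiv \<Gamma> \<sigma> M N"
  then show "ctx_equiv \<Gamma> \<sigma> M N"
    unfolding ctx_equiv_def
    by (blast intro: sim_preorder_imp_ctx_preorder bisim_equiv_imp_sim_preorder bisim_equiv_sym)
qed

end
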